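(* Let $n=n_d\ge1$, $1\le s=s_d\le d$, $\alpha=\alpha_d\in(0,1)$ and $a=a_d>0$ depend on $d$. Let $L>0$ be a constant depending only on $c_+$ such that $\exp(c_+x^2)-1\le Lx^2$ for all $0\le x\le2$. If, as $d\to\infty$, $n\alpha^2/d\to+\infty$ with $n\alpha^2/d\gg\log d$, and $$a\le\frac{\sigma}{16L}\sqrt{\frac{d\log d}{n\alpha^2}},$$ then $$\liminf_{d\to+\infty}\ \inf_{Q\in\mathcal{Q}_\alpha}\inf_{\hat\eta\in\mathcal{T}}\sup_{\theta\in\Theta_d^+(s,a)}\mathbb{E}_{Q(P_\theta^{\otimes n})}|\hat\eta-\eta|\ \ge\ \frac18 .$$
   Context: Notation: $a_d\gg b_d$ means $a_d/b_d\to\infty$ as $d\to\infty$. Model: $\sigma>0$, $\theta\in\mathbb{R}^d$; $X^1,\dots,X^n$ are i.i.d. random vectors in $\mathbb{R}^d$ with law $P_\theta$, $X^i=\theta+\sigma\xi^i$, where $\xi^i$ has i.i.d. coordinates whose common law on $\mathbb{R}$ (not depending on $d$) is symmetric around $0$, has variance $1$ and is $c$-strongly log-concave for a constant $c>0$: it has density $p(x)=\exp(-\phi_0(x))\exp(-cx^2/2)$ with $\phi_0:\mathbb{R}\to\mathbb{R}$ a finite even convex function. Moreover the potential $\phi=-\log p$ has curvature bounded from above by a constant $c_+>0$: $\phi(tx+(1-t)y)-[t\phi(x)+(1-t)\phi(y)]\ge-\frac{c_+}2t(1-t)(x-y)^2$ for all $x,y\in\mathbb{R}$, $t\in(0,1)$.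 $\Theta_d^+(s,a)$ is the set of $\theta\in\mathbb{R}^d$ for which there is $S\subseteq\{1,\dots,d\}$ with at most $s$ elements such that $\theta_j\ge a$ for $j\in S$ and $\theta_j=0$ for $j\notin S$. Put $\eta=(I(\theta_j\ne0))_{j=1,\dots,d}$ and $|\hat\eta-\eta|=\sum_{j=1}^d I(\hat\eta_j\neq\eta_j)$. $\mathcal{Q}_\alpha$ is the set of all non-interactive $\alpha$-locally differentially private mechanisms: sequences $Q=(Q^1,\dots,Q^n)$ of Markov kernels from $\mathbb{R}^d$ to $\mathbb{R}^d$ with $Q^i(A\mid x)\le e^\alpha Q^i(A\mid x')$ for all $i$, all measurable $A$, all $x,x'\in\mathbb{R}^d$; given the $X^i$, the $Z^i\sim Q^i(\cdot\mid X^i)$ are drawn independently, and $Q(P_\theta^{\otimes n})$ denotes the law of $(Z^1,\dots,Z^n)$. $\mathcal{T}$ is the set of separable selectors: measurable $\hat\eta=\hat\eta(Z^1,\dots,Z^n)\in\{0,1\}^d$ such that for each $j$, $\hat\eta_j$ depends only on $(Z^i_j)_{i=1,\dots,n}$. *)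

theory Defs
  imports "HOL-Probability.Probability"
begin

text \<open>
  The dimension d and the sample size n vary inside the statement, so vectors are extensional
  functions on the index sets \<open>{..<d}\<close> and \<open>{..<n}\<close>: a vector of real d-space is an element
  of the space of \<open>Rvec d\<close>, and a sample \<open>z\<close> is an element of the space of \<open>Rsample n d\<close>,
  with \<open>z i j\<close> the j-th coordinate of the i-th observation.
\<close>

definition Rvec :: "nat \<Rightarrow> (nat \<Rightarrow> real) measure" where
  "Rvec d = (\<Pi>\<^sub>M j\<in>{..<d}. borel)"

definition Rsample :: "nat \<Rightarrow> nat \<Rightarrow> (nat \<Rightarrow> nat \<Rightarrow> real) measure" where
  "Rsample n d = (\<Pi>\<^sub>M i\<in>{..<n}. Rvec d)"

definition strongly_log_concave :: "real \<Rightarrow> (real \<Rightarrow> real) \<Rightarrow> bool" where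
  "strongly_log_concave c p \<longleftrightarrow>
     (\<exists>\<phi>\<^sub>0 :: real \<Rightarrow> real. convex_on UNIV \<phi>\<^sub>0 \<and> (\<forall>x. \<phi>\<^sub>0 (- x) = \<phi>\<^sub>0 x) \<and>
        (\<forall>x. p x = exp (- \<phi>\<^sub>0 x) * exp (- c * x\<^sup>2 / 2)))"

definition curvature_bounded_above :: "real \<Rightarrow> (real \<Rightarrow> real) \<Rightarrow> bool" where
  "curvature_bounded_above C \<phi> \<longleftrightarrow>
     (\<forall>x y t. 0 < t \<and> t < 1 \<longrightarrow>
        \<phi> (t * x + (1 - t) * y) - (t * \<phi> x + (1 - t) * \<phi> y)
          \<ge> - (C / 2) * t * (1 - t) * (x - y)\<^sup>2)"

definition noise_law :: "real \<Rightarrow> real \<Rightarrow> real measure \<Rightarrow> bool" where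
  "noise_law c C \<nu> \<longleftrightarrow>
     prob_space \<nu> \<and>
     distr \<nu> borel uminus = \<nu> \<and>
     prob_space.variance \<nu> (\<lambda>x. x) = 1 \<and>
     (\<exists>p. \<nu> = density lborel (\<lambda>x. ennreal (p x)) \<and>
          strongly_log_concave c p \<and>
          curvature_bounded_above C (\<lambda>x. - ln (p x)))"

definition shift_law :: "real measure \<Rightarrow> real \<Rightarrow> nat \<Rightarrow> (nat \<Rightarrow> real) \<Rightarrow> (nat \<Rightarrow> real) measure" where
  "shift_law \<nu> \<sigma> d \<theta> =
     distr (\<Pi>\<^sub>M j\<in>{..<d}. \<nu>) (Rvec d) (\<lambda>\<xi>. \<lambda>j\<in>{..<d}. \<theta> j + \<sigma> * \<xi> j)"

definition sparse_class :: "nat \<Rightarrow> nat \<Rightarrow> real \<Rightarrow> (nat \<Rightarrow> real) set" where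
  "sparse_class d s a =
     {\<theta> \<in> {..<d} \<rightarrow>\<^sub>E UNIV. \<exists>S \<subseteq> {..<d}. card S \<le> s \<and>
        (\<forall>j\<in>S. \<theta> j \<ge> a) \<and> (\<forall>j\<in>{..<d} - S. \<theta> j = 0)}"

text \<open>
  A mechanism \<open>Q\<close> consists of the kernels \<open>Q i\<close> for \<open>i < n\<close>; its values at \<open>i \<ge> n\<close> are not
  used. Measurability into \<^const>\<open>prob_algebra\<close> says that \<open>Q i\<close> is a Markov kernel.
\<close>

definition private_mechanisms ::
  "nat \<Rightarrow> nat \<Rightarrow> real \<Rightarrow> (nat \<Rightarrow> (nat \<Rightarrow> real) \<Rightarrow> (nat \<Rightarrow> real) measure) set" where
  "private_mechanisms n d \<alpha> =
     {Q. \<forall>i<n. Q i \<in> Rvec d \<rightarrow>\<^sub>M prob_algebra (Rvec d) \<and>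
        (\<forall>A\<in>sets (Rvec d). \<forall>x\<in>space (Rvec d). \<forall>x'\<in>space (Rvec d).
           measure (Q i x) A \<le> exp \<alpha> * measure (Q i x') A)}"

definition privatized_law ::
  "nat \<Rightarrow> (nat \<Rightarrow> (nat \<Rightarrow> real) \<Rightarrow> (nat \<Rightarrow> real) measure) \<Rightarrow> (nat \<Rightarrow> real) measure
     \<Rightarrow> (nat \<Rightarrow> nat \<Rightarrow> real) measure" where
  "privatized_law n Q P =
     (\<Pi>\<^sub>M i\<in>{..<n}. P) \<bind> (\<lambda>x. \<Pi>\<^sub>M i\<in>{..<n}. Q i (x i))"

definition separable_selectors ::
  "nat \<Rightarrow> nat \<Rightarrow> ((nat \<Rightarrow> nat \<Rightarrow> real) \<Rightarrow> nat \<Rightarrow> nat) set" where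
  "separable_selectors n d =
     {h \<in> Rsample n d \<rightarrow>\<^sub>M (\<Pi>\<^sub>M j\<in>{..<d}. count_space {0, 1}).
        \<forall>j<d. \<forall>z\<in>space (Rsample n d). \<forall>z'\<in>space (Rsample n d).
          (\<forall>i<n. z i j = z' i j) \<longrightarrow> h z j = h z' j}"

definition support_pattern :: "nat \<Rightarrow> (nat \<Rightarrow> real) \<Rightarrow> nat \<Rightarrow> nat" where
  "support_pattern d \<theta> = (\<lambda>j\<in>{..<d}. of_bool (\<theta> j \<noteq> 0))"

definition hamming :: "nat \<Rightarrow> (nat \<Rightarrow> nat) \<Rightarrow> (nat \<Rightarrow> nat) \<Rightarrow> nat" where
  "hamming d u v = (\<Sum>j<d. of_bool (u j \<noteq> v j))"

text \<open>
  The risk is the expected Hamming loss; it is valued in \<^typ>\<open>ennreal\<close>, a complete lattice,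
  so that infima over mechanisms and selectors and suprema over parameters are total.
\<close>

definition hamming_risk ::
  "real measure \<Rightarrow> real \<Rightarrow> nat \<Rightarrow> nat \<Rightarrow> (nat \<Rightarrow> (nat \<Rightarrow> real) \<Rightarrow> (nat \<Rightarrow> real) measure)
     \<Rightarrow> ((nat \<Rightarrow> nat \<Rightarrow> real) \<Rightarrow> nat \<Rightarrow> nat) \<Rightarrow> (nat \<Rightarrow> real) \<Rightarrow> ennreal" where
  "hamming_risk \<nu> \<sigma> n d Q h \<theta> =
     (\<integral>\<^sup>+ z. ennreal (real (hamming d (h z) (support_pattern d \<theta>)))
        \<partial>privatized_law n Q (shift_law \<nu> \<sigma> d \<theta>))"

end

theory Submission
  imports Defs
begin

text \<open>
  Compare the null parameter with the \<open>d\<close> parameters having a single nonzero coordinate, equal to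
  \<open>a\<close>. With \<open>t = a / \<sigma>\<close>, let \<open>P\<^sub>0\<close> and \<open>P\<^sub>j = (1 + F\<^sub>j) P\<^sub>0\<close> be the corresponding laws of one
  observation; the \<open>F\<^sub>j\<close> are orthogonal in \<open>L\<^sup>2(P\<^sub>0)\<close> with squared norm at most \<open>exp (C t\<^sup>2) - 1\<close>.
  A private channel turns \<open>P\<^sub>0, P\<^sub>j\<close> into \<open>m\<^sub>0, m\<^sub>j = (1 + g\<^sub>j) m\<^sub>0\<close>, and orthogonality makes one
  observation share a single budget among all coordinates:
  the sum over \<open>j\<close> of \<open>\<integral> g\<^sub>j\<^sup>2 dm\<^sub>0\<close> is at most \<open>(exp \<alpha> - 1)\<^sup>2 (exp (C t\<^sup>2) - 1)\<close>.

  Chi-square divergences tensorize, so by Cauchy--Schwarz the law \<open>M\<^sub>j\<close> of the privatized sample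
  satisfies \<open>M\<^sub>j(A)\<^sup>2 \<le> M\<^sub>0(A) exp S\<^sub>j\<close>, where the \<open>S\<^sub>j\<close> sum to at most \<open>d ln d / 64\<close>. A risk below
  \<open>1 / 8\<close> at the null parameter yields some \<open>j\<close> for which both \<open>S\<^sub>j \<le> ln d / 32\<close> and the false
  positive probability at \<open>j\<close> is at most \<open>1 / (4 d)\<close>; then the spike at \<open>j\<close> is missed with
  probability at least \<open>1 / 2\<close>. No lower bound on \<open>L\<close> is assumed, but unit variance forces \<open>L \<ge> 1\<close>.
\<close>

section \<open>Chi-square contraction of private channels\<close>

text \<open>The product is dominated by \<open>f\<^sup>2 + g\<^sup>2\<close>. The inequality follows
  from the nonnegativity of the quadratic polynomial \<open>\<integral>(f - t * g)\<^sup>2\<close>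
  in \<open>t\<close>, evaluated at its minimizer \<open>?B / ?C\<close>.\<close>

lemma
  fixes f g :: "'a \<Rightarrow> real"
  assumes [measurable]: "f \<in> borel_measurable M" "g \<in> borel_measurable M"
    and f2: "integrable M (\<lambda>x. (f x)\<^sup>2)" and g2: "integrable M (\<lambda>x. (g x)\<^sup>2)"
  shows integrable_mult_of_squares: "integrable M (\<lambda>x. f x * g x)"
    and Cauchy_Schwarz_integral:
      "(\<integral>x. f x * g x \<partial>M)\<^sup>2 \<le> (\<integral>x. (f x)\<^sup>2 \<partial>M) * (\<integral>x. (g x)\<^sup>2 \<partial>M)"
proof -
  show int: "integrable M (\<lambda>x. f x * g x)"
  proof (rule Bochner_Integration.integrable_bound)
    show "integrable M (\<lambda>x. (f x)\<^sup>2 + (g x)\<^sup>2)"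
      using f2 g2 by simp
    have "norm (a * b) \<le> norm (a\<^sup>2 + b\<^sup>2)" for a b :: real
    proof -
      have "2 * (\<bar>a\<bar> * \<bar>b\<bar>) \<le> a\<^sup>2 + b\<^sup>2"
        using sum_squares_bound[of "\<bar>a\<bar>" "\<bar>b\<bar>"] by (simp add: mult.assoc)
      moreover have "0 \<le> \<bar>a\<bar> * \<bar>b\<bar>"
        by simp
      ultimately have "\<bar>a\<bar> * \<bar>b\<bar> \<le> a\<^sup>2 + b\<^sup>2"
        by linarith
      then show ?thesis
        by (simp add: abs_mult)
    qed
    then show "AE x in M. norm (f x * g x) \<le> norm ((f x)\<^sup>2 + (g x)\<^sup>2)"
      by simp
  qed simp
  let ?A = "\<integral>x. (f x)\<^sup>2 \<partial>M" and ?B = "\<integral>x. f x * g x \<partial>M" and ?C = "\<integral>x. (g x)\<^sup>2 \<partial>M"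
  have quad: "0 \<le> ?A - 2 * t * ?B + t\<^sup>2 * ?C" for t
  proof -
    have "0 \<le> (\<integral>x. (f x - t * g x)\<^sup>2 \<partial>M)"
      by simp
    also have "\<dots> = (\<integral>x. (f x)\<^sup>2 - 2 * t * (f x * g x) + t\<^sup>2 * (g x)\<^sup>2 \<partial>M)"
      by (simp add: power2_diff power_mult_distrib algebra_simps)
    also have "\<dots> = ?A - 2 * t * ?B + t\<^sup>2 * ?C"
      using int f2 g2 by simp
    finally show ?thesis .
  qed
  show "?B\<^sup>2 \<le> ?A * ?C"
  proof (cases "?C = 0")
    case True
    have "?B = 0"
    proof (rule ccontr)
      assume "?B \<noteq> 0"
      \<comment> \<open>With \<open>?C = 0\<close> the polynomial is linear in \<open>t\<close>, and
        this value of \<open>t\<close> makes it equal to -1.\<close>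
      then show False
        using quad[of "(?A + 1) / (2 * ?B)"] True by (simp add: field_simps)
    qed
    then show ?thesis
      using True by simp
  next
    case False
    moreover have "0 \<le> ?C"
      by simp
    ultimately have "0 < ?C"
      by linarith
    then show ?thesis
      using quad[of "?B / ?C"] by (simp add: field_simps power2_eq_square)
  qed
qed

section \<open>Integrals and densities under setwise domination of measures\<close>

lemma nn_integral_le_mult:
  assumes sets: "sets N = sets M"
    and le: "\<And>A. A \<in> sets M \<Longrightarrow> emeasure N A \<le> c * emeasure M A"
    and [measurable]: "f \<in> borel_measurable M"
  shows "(\<integral>\<^sup>+x. f x \<partial>N) \<le> c * (\<integral>\<^sup>+x. f x \<partial>M)"
proof -
  have "N \<le> scale_measure c M"
    using sets le by (subst le_measure) auto
  then have "(\<integral>\<^sup>+x. f x \<partial>N) \<le> (\<integral>\<^sup>+x. f x \<partial>scale_measure c M)"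
    using sets by (intro nn_integral_mono_measure) auto
  then show ?thesis
    by (simp add: nn_integral_scale_measure)
qed

lemma integral_le_mult:
  fixes f :: "'a \<Rightarrow> real"
  assumes fin: "finite_measure M" and sets: "sets N = sets M" and c: "0 \<le> c"
    and le: "\<And>A. A \<in> sets M \<Longrightarrow> emeasure N A \<le> ennreal c * emeasure M A"
    and f[measurable]: "f \<in> borel_measurable M"
    and bd: "\<And>x. 0 \<le> f x" "\<And>x. f x \<le> B"
  shows "(\<integral>x. f x \<partial>N) \<le> c * (\<integral>x. f x \<partial>M)"
proof -
  interpret finite_measure M by fact
  have int: "integrable M f"
    by (rule integrable_const_bound[of _ B]) (use bd in auto)
  have [measurable]: "f \<in> borel_measurable N"
    using f sets by (simp cong: measurable_cong_sets)
  have "(\<integral>\<^sup>+x. ennreal (f x) \<partial>N) \<le> ennreal c * (\<integral>\<^sup>+x. ennreal (f x) \<partial>M)"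
    by (rule nn_integral_le_mult[OF sets le]) auto
  also have "\<dots> = ennreal (c * (\<integral>x. f x \<partial>M))"
    using int bd c by (simp add: nn_integral_eq_integral ennreal_mult')
  finally have "enn2real (\<integral>\<^sup>+x. ennreal (f x) \<partial>N) \<le> c * (\<integral>x. f x \<partial>M)"
    using c bd by (intro enn2real_leI) (auto intro!: mult_nonneg_nonneg)
  then show ?thesis
    using bd by (subst integral_eq_nn_integral) auto
qed

text \<open>The positive part \<open>p\<close> and the negative part \<open>q\<close> of
  \<open>h\<close> have a common mean \<open>m\<close> under \<open>M\<close>. Under
  \<open>N\<close> both means lie between \<open>exp (- \<alpha>) * m\<close> and
  \<open>exp \<alpha> * m\<close>, so they differ by at most
  \<open>(exp \<alpha> - exp (- \<alpha>)) * m\<close>. As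
  \<open>exp \<alpha> + exp (- \<alpha>)\<close> is at least 2, this is at most
  \<open>(exp \<alpha> - 1) * (2 * m)\<close>, and \<open>2 * m\<close> is the mean of the absolute
  value of \<open>h\<close>.\<close>

lemma integral_close:
  fixes h :: "'a \<Rightarrow> real"
  assumes M: "prob_space M" and N: "prob_space N" and sets: "sets N = sets M" and \<alpha>: "0 \<le> \<alpha>"
    and le1: "\<And>A. A \<in> sets M \<Longrightarrow> emeasure N A \<le> ennreal (exp \<alpha>) * emeasure M A"
    and le2: "\<And>A. A \<in> sets M \<Longrightarrow> emeasure M A \<le> ennreal (exp \<alpha>) * emeasure N A"
    and h[measurable]: "h \<in> borel_measurable M" and bd: "\<And>x. \<bar>h x\<bar> \<le> B"
    and zero: "(\<integral>x. h x \<partial>M) = 0"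
  shows "\<bar>\<integral>x. h x \<partial>N\<bar> \<le> (exp \<alpha> - 1) * (\<integral>x. \<bar>h x\<bar> \<partial>M)"
proof -
  interpret M: prob_space M by fact
  interpret N: prob_space N by fact
  define p q where "p x = max 0 (h x)" and "q x = max 0 (- h x)" for x
  have hN[measurable]: "h \<in> borel_measurable N"
    using h sets by (simp cong: measurable_cong_sets)
  have pq: "0 \<le> p x" "p x \<le> B" "0 \<le> q x" "q x \<le> B" "h x = p x - q x" "\<bar>h x\<bar> = p x + q x" for x
    using bd[of x] by (auto simp: p_def q_def)
  have [measurable]: "p \<in> borel_measurable M" "q \<in> borel_measurable M"
    "p \<in> borel_measurable N" "q \<in> borel_measurable N"
    unfolding p_def q_def by simp_all
  have int: "integrable M p" "integrable M q" "integrable N p" "integrable N q"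
    using pq by (auto intro!: M.integrable_const_bound[of _ B] N.integrable_const_bound[of _ B])
  have 1: "(\<integral>x. p x \<partial>N) \<le> exp \<alpha> * (\<integral>x. p x \<partial>M)" "(\<integral>x. q x \<partial>N) \<le> exp \<alpha> * (\<integral>x. q x \<partial>M)"
    using pq by (auto intro!: integral_le_mult[OF M.finite_measure_axioms sets _ le1])
  have 2: "(\<integral>x. p x \<partial>M) \<le> exp \<alpha> * (\<integral>x. p x \<partial>N)" "(\<integral>x. q x \<partial>M) \<le> exp \<alpha> * (\<integral>x. q x \<partial>N)"
    using pq sets by (auto intro!: integral_le_mult[OF N.finite_measure_axioms sets[symmetric] _ le2])
  have eq: "(\<integral>x. p x \<partial>M) = (\<integral>x. q x \<partial>M)"
    using zero int by (simp add: pq(5))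
  define m where "m = (\<integral>x. p x \<partial>M)"
  have m: "0 \<le> m"
    using pq by (simp add: m_def)
  have "exp (- \<alpha>) * m \<le> (\<integral>x. p x \<partial>N)" "exp (- \<alpha>) * m \<le> (\<integral>x. q x \<partial>N)"
    using 2 eq by (simp_all add: m_def exp_minus field_simps)
  then have "\<bar>(\<integral>x. p x \<partial>N) - (\<integral>x. q x \<partial>N)\<bar> \<le> (exp \<alpha> - exp (- \<alpha>)) * m"
    using 1 eq by (auto simp: m_def algebra_simps abs_le_iff)
  also have "\<dots> \<le> (2 * (exp \<alpha> - 1)) * m"
  proof (rule mult_right_mono[OF _ m])
    have "2 \<le> exp \<alpha> + exp (- \<alpha>)"
      using exp_ge_add_one_self[of \<alpha>] exp_ge_add_one_self[of "- \<alpha>"] by linarith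
    then show "exp \<alpha> - exp (- \<alpha>) \<le> 2 * (exp \<alpha> - 1)"
      by simp
  qed
  also have "\<dots> = (exp \<alpha> - 1) * (\<integral>x. \<bar>h x\<bar> \<partial>M)"
    using eq int by (simp add: pq(6) m_def)
  finally show ?thesis
    using int by (simp add: pq(5))
qed

text \<open>A Radon-Nikodym derivative exceeds \<open>c\<close> at most on a null set; truncating it
  at \<open>c\<close> gives a real-valued version whose bounds hold everywhere, so that later
  integrability claims need no exceptional sets.\<close>

lemma bounded_density_exists:
  assumes M: "finite_measure M" and N: "finite_measure N" and sets: "sets N = sets M" and c: "0 \<le> c"
    and le: "\<And>A. A \<in> sets M \<Longrightarrow> emeasure N A \<le> ennreal c * emeasure M A"
  obtains r :: "'a \<Rightarrow> real" where "r \<in> borel_measurable M" "\<And>x. 0 \<le> r x" "\<And>x. r x \<le> c"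
    "N = density M (\<lambda>x. ennreal (r x))"
proof -
  interpret M: finite_measure M by fact
  have "absolutely_continuous M N"
  proof (unfold absolutely_continuous_def, safe)
    fix A assume "A \<in> null_sets M"
    then show "A \<in> null_sets N"
      using le[of A] sets by (auto simp: null_sets_def)
  qed
  then obtain f where f[measurable]: "f \<in> borel_measurable M" and dens: "density M f = N"
    using M.Radon_Nikodym_finite_measure[OF N sets] by blast
  \<comment> \<open>On the set where the derivative exceeds \<open>c\<close>, domination leaves no
    room for the integral of the excess.\<close>
  define A where "A = {x \<in> space M. ennreal c < f x}"
  have A[measurable]: "A \<in> sets M"
    unfolding A_def by measurable
  let ?I = "\<integral>\<^sup>+x. (f x - ennreal c) * indicator A x \<partial>M"
  have "ennreal c * emeasure M A + ?I = (\<integral>\<^sup>+x. ennreal c * indicator A x + (f x - ennreal c) * indicator A x \<partial>M)"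
    by (subst nn_integral_add) (auto simp: nn_integral_cmult)
  also have "\<dots> = (\<integral>\<^sup>+x. f x * indicator A x \<partial>M)"
    by (intro nn_integral_cong) (auto simp: A_def indicator_def)
  also have "\<dots> = emeasure N A"
    by (simp add: dens[symmetric] emeasure_density)
  also have "\<dots> \<le> ennreal c * emeasure M A + 0"
    using le[OF A] by simp
  finally have "?I = 0"
    using M.emeasure_finite[of A]
    by (auto simp: ennreal_add_left_cancel_le ennreal_mult_eq_top_iff top_unique)
  then have "AE x in M. (f x - ennreal c) * indicator A x = 0"
    by (subst (asm) nn_integral_0_iff_AE) auto
  then have ae: "AE x in M. f x \<le> ennreal c"
    using AE_space
  proof (eventually_elim)
    case (elim x)
    show ?case
    proof (rule ccontr)
      assume less: "\<not> f x \<le> ennreal c"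
      with elim have "f x - ennreal c = 0"
        by (cases "x \<in> space M") (auto simp: A_def indicator_def)
      with less show False
        using ennreal_minus_eq_0 by blast
    qed
  qed
  define r where "r x = enn2real (min (ennreal c) (f x))" for x
  have r: "ennreal (r x) = min (ennreal c) (f x)" for x
    unfolding r_def by (rule ennreal_enn2real) (simp add: min_less_iff_disj)
  show ?thesis
  proof
    show "r \<in> borel_measurable M"
      unfolding r_def by measurable
    show "0 \<le> r x" for x
      by (simp add: r_def)
    show "r x \<le> c" for x
      using r[of x] c by (metis ennreal_le_iff min.cobounded1)
    show "N = density M (\<lambda>x. ennreal (r x))"
      unfolding dens[symmetric]
    proof (intro density_cong)
      show "AE x in M. f x = ennreal (r x)"
        using ae by eventually_elim (simp add: r min_def antisym)
    qed (auto simp: r)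
  qed
qed

text \<open>The argument is by duality. With \<open>g j = r j - 1\<close> and \<open>G j x\<close>
  the mean of \<open>g j\<close> under \<open>K x\<close>, the quantity to bound is the sum
  \<open>S\<close> of the squared norms of the \<open>g j\<close>, and \<open>S\<close> is also the
  mean under \<open>P\<close> of \<open>T\<close>, the sum of the \<open>F j * G j\<close>. Privacy
  bounds \<open>T\<close> pointwise, and orthogonality of the \<open>F j\<close> removes the cross
  terms after integration. The outcome is
  \<open>S\<^sup>2 \<le> (exp \<alpha> - 1)\<^sup>2 * (S * v)\<close>, in which \<open>v\<close> is
  not multiplied by the number of indices.\<close>

lemma private_channel_chi_square:
  fixes F :: "'j \<Rightarrow> 'a \<Rightarrow> real"
  assumes P: "prob_space P" and J: "finite J" and \<alpha>: "0 \<le> \<alpha>"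
    and K: "K \<in> P \<rightarrow>\<^sub>M prob_algebra N"
    and priv: "\<And>A x x'. A \<in> sets N \<Longrightarrow> x \<in> space P \<Longrightarrow> x' \<in> space P \<Longrightarrow>
      emeasure (K x) A \<le> ennreal (exp \<alpha>) * emeasure (K x') A"
    and F[measurable]: "\<And>j. j \<in> J \<Longrightarrow> F j \<in> borel_measurable P"
    and F2: "\<And>j. j \<in> J \<Longrightarrow> integrable P (\<lambda>x. (F j x)\<^sup>2)"
    and F1: "\<And>j x. j \<in> J \<Longrightarrow> x \<in> space P \<Longrightarrow> 0 \<le> 1 + F j x"
    and F0: "\<And>j. j \<in> J \<Longrightarrow> (\<integral>x. F j x \<partial>P) = 0"
    and v0: "0 \<le> v" and v: "\<And>j. j \<in> J \<Longrightarrow> (\<integral>x. (F j x)\<^sup>2 \<partial>P) \<le> v"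
    and orth: "\<And>j k. j \<in> J \<Longrightarrow> k \<in> J \<Longrightarrow> j \<noteq> k \<Longrightarrow> (\<integral>x. F j x * F k x \<partial>P) = 0"
  shows "\<exists>r. (\<forall>j\<in>J. r j \<in> borel_measurable N \<and> (\<forall>z. 0 \<le> r j z \<and> r j z \<le> exp \<alpha>) \<and>
             density P (\<lambda>x. ennreal (1 + F j x)) \<bind> K = density (P \<bind> K) (\<lambda>z. ennreal (r j z))) \<and>
           (\<Sum>j\<in>J. \<integral>z. (r j z - 1)\<^sup>2 \<partial>(P \<bind> K)) \<le> (exp \<alpha> - 1)\<^sup>2 * v"
proof -
  interpret P: prob_space P by fact
  define m0 where "m0 = P \<bind> K"
  define Pj where "Pj j = density P (\<lambda>x. ennreal (1 + F j x))" for j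
  have PP: "P \<in> space (prob_algebra P)"
    by (simp add: space_prob_algebra P)
  have Ksub: "K \<in> P \<rightarrow>\<^sub>M subprob_algebra N"
    using K by (rule measurable_prob_algebraD)
  have Kp: "prob_space (K x)" and Ks: "sets (K x) = sets N" if "x \<in> space P" for x
    using measurable_space[OF K that] by (auto simp: space_prob_algebra)
  have m0s[simp, measurable_cong]: "sets m0 = sets N"
    unfolding m0_def by (rule sets_bind'[OF PP K])
  have m0p: "prob_space m0"
    unfolding m0_def by (rule prob_space_bind'[OF PP K])
  interpret m0: prob_space m0 by (rule m0p)
  have intF: "integrable P (F j)" if "j \<in> J" for j
    using that F2 by (auto intro: P.square_integrable_imp_integrable[OF F])
  have Pjp: "prob_space (Pj j)" if j: "j \<in> J" for j
  proof (rule prob_spaceI)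
    have "emeasure (Pj j) (space (Pj j)) = (\<integral>\<^sup>+x. ennreal (1 + F j x) \<partial>P)"
      using j by (auto simp: Pj_def emeasure_density intro!: nn_integral_cong)
    also have "\<dots> = ennreal (\<integral>x. 1 + F j x \<partial>P)"
      using j F1[OF j] intF[OF j] by (intro nn_integral_eq_integral) auto
    also have "(\<integral>x. 1 + F j x \<partial>P) = 1"
      using intF[OF j] F0[OF j] by (simp add: P.prob_space)
    finally show "emeasure (Pj j) (space (Pj j)) = 1" by simp
  qed
  have Pjs: "sets (Pj j) = sets P" for j
    by (simp add: Pj_def)
  have Kj: "K \<in> Pj j \<rightarrow>\<^sub>M prob_algebra N" for j
    using K by (simp add: Pjs cong: measurable_cong_sets)
  have PjP: "Pj j \<in> space (prob_algebra (Pj j))" if "j \<in> J" for j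
    by (simp add: space_prob_algebra Pjp that)
  define m where "m j = Pj j \<bind> K" for j
  have ms: "sets (m j) = sets m0" and mp: "prob_space (m j)" if "j \<in> J" for j
    using sets_bind'[OF PjP[OF that] Kj] prob_space_bind'[OF PjP[OF that] Kj] by (auto simp: m_def)
  \<comment> \<open>\<open>m0\<close> is the mixture of the \<open>K x'\<close> over
    \<open>P\<close>; averaging the privacy bound over \<open>x'\<close> compares it with each
    \<open>K x\<close> in both directions.\<close>
  have Kle: "emeasure (K x) A \<le> ennreal (exp \<alpha>) * emeasure m0 A"
    and Kge: "emeasure m0 A \<le> ennreal (exp \<alpha>) * emeasure (K x) A"
    if x: "x \<in> space P" and A: "A \<in> sets N" for x A
  proof -
    have m0A: "emeasure m0 A = (\<integral>\<^sup>+x'. emeasure (K x') A \<partial>P)"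
      unfolding m0_def by (rule emeasure_bind_prob_algebra[OF PP K A])
    have [measurable]: "(\<lambda>x'. emeasure (K x') A) \<in> borel_measurable P"
      using Ksub A by measurable
    have "emeasure (K x) A = (\<integral>\<^sup>+x'. emeasure (K x) A \<partial>P)"
      by (simp add: P.emeasure_space_1)
    also have "\<dots> \<le> (\<integral>\<^sup>+x'. ennreal (exp \<alpha>) * emeasure (K x') A \<partial>P)"
      by (intro nn_integral_mono priv A x)
    finally show "emeasure (K x) A \<le> ennreal (exp \<alpha>) * emeasure m0 A"
      by (simp add: nn_integral_cmult m0A)
    have "emeasure m0 A \<le> (\<integral>\<^sup>+x'. ennreal (exp \<alpha>) * emeasure (K x) A \<partial>P)"
      unfolding m0A by (intro nn_integral_mono priv A x)
    then show "emeasure m0 A \<le> ennreal (exp \<alpha>) * emeasure (K x) A"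
      by (simp add: P.emeasure_space_1)
  qed
  \<comment> \<open>Each \<open>m j\<close> is a mixture of the \<open>K x\<close> too, so its
    density with respect to \<open>m0\<close> is at most \<open>exp \<alpha>\<close>; this makes
    \<open>g j\<close> bounded.\<close>
  have mle: "emeasure (m j) A \<le> ennreal (exp \<alpha>) * emeasure m0 A" if j: "j \<in> J" and A: "A \<in> sets m0" for j A
  proof -
    interpret Pj: prob_space "Pj j" using j by (rule Pjp)
    have "emeasure (m j) A = (\<integral>\<^sup>+x. emeasure (K x) A \<partial>Pj j)"
      unfolding m_def using A by (intro emeasure_bind_prob_algebra[OF PjP[OF j] Kj]) simp
    also have "\<dots> \<le> (\<integral>\<^sup>+x. ennreal (exp \<alpha>) * emeasure m0 A \<partial>Pj j)"
      using A by (intro nn_integral_mono Kle) (auto simp: Pj_def)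
    finally show ?thesis
      by (simp add: Pj.emeasure_space_1)
  qed
  have "\<exists>r. r \<in> borel_measurable m0 \<and> (\<forall>z. 0 \<le> r z) \<and> (\<forall>z. r z \<le> exp \<alpha>) \<and> m j = density m0 (\<lambda>z. ennreal (r z))"
    if j: "j \<in> J" for j
  proof -
    interpret mj: prob_space "m j" using j by (rule mp)
    show ?thesis
      by (rule bounded_density_exists[OF m0.finite_measure_axioms mj.finite_measure_axioms ms[OF j] _ mle[OF j]])
        auto
  qed
  then obtain r where r: "r j \<in> borel_measurable m0" "0 \<le> r j z" "r j z \<le> exp \<alpha>"
    "m j = density m0 (\<lambda>z. ennreal (r j z))" if "j \<in> J" for j z
    by metis
  define g where "g j z = r j z - 1" for j z
  have g[measurable]: "g j \<in> borel_measurable m0" "g j \<in> borel_measurable N" if "j \<in> J" for j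
    using r(1)[OF that] unfolding g_def by (auto cong: measurable_cong_sets)
  have gb: "\<bar>g j z\<bar> \<le> exp \<alpha> + 1" if "j \<in> J" for j z
    using r(2,3)[OF that, of z] by (auto simp: g_def abs_le_iff)
  have gi: "integrable m0 (g j)" if "j \<in> J" for j
    using gb that by (intro m0.integrable_const_bound[of _ "exp \<alpha> + 1"]) auto
  have ggi: "integrable m0 (\<lambda>z. g j z * g k z)" if "j \<in> J" "k \<in> J" for j k
    using gb that
    by (intro m0.integrable_const_bound[of _ "(exp \<alpha> + 1) * (exp \<alpha> + 1)"])
      (auto simp: abs_mult intro!: mult_mono add_nonneg_nonneg)
  have gm: "(\<integral>z. h z \<partial>m j) = (\<integral>z. (1 + g j z) * h z \<partial>m0)"
    if "j \<in> J" "h \<in> borel_measurable m0" for j and h :: "_ \<Rightarrow> real"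
    using r[OF that(1)] that by (simp add: g_def integral_density)
  have g0: "(\<integral>z. g j z \<partial>m0) = 0" if j: "j \<in> J" for j
  proof -
    interpret mj: prob_space "m j" using j by (rule mp)
    have "1 = (\<integral>z. (1::real) \<partial>m j)"
      by (simp add: mj.prob_space)
    also have "\<dots> = 1 + (\<integral>z. g j z \<partial>m0)"
      using gm[OF j, of "\<lambda>_. 1"] gi[OF j] by (simp add: m0.prob_space)
    finally show ?thesis by simp
  qed
  define G where "G j x = (\<integral>z. g j z \<partial>K x)" for j x
  have G[measurable]: "G j \<in> borel_measurable P" if "j \<in> J" for j
    unfolding G_def using Ksub that by measurable
  have Gb: "\<bar>G j x\<bar> \<le> exp \<alpha> + 1" if "j \<in> J" "x \<in> space P" for j x
  proof -
    interpret Kx: prob_space "K x" using that by (intro Kp)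
    have "\<bar>G j x\<bar> \<le> (\<integral>z. \<bar>g j z\<bar> \<partial>K x)"
      unfolding G_def by (rule integral_abs_bound)
    also have "\<dots> \<le> exp \<alpha> + 1"
      using gb[OF that(1)] g(2)[OF that(1)] Ks[OF that(2)]
      by (intro Kx.integral_le_const Kx.integrable_const_bound[of _ "exp \<alpha> + 1"])
        (auto cong: measurable_cong_sets)
    finally show ?thesis .
  qed
  have one: "AE x in M. emeasure (K x) (space (K x)) \<le> ennreal 1" if "space M = space P" for M
    using that prob_space.emeasure_space_1[OF Kp] by (intro AE_I2) auto
  have intb: "(\<integral>z. g j z \<partial>(M \<bind> K)) = (\<integral>x. G j x \<partial>M)"
    if j: "j \<in> J" and M: "prob_space M" "sets M = sets P" for j M
    unfolding G_def
    using g(2)[OF j] gb[OF j] Ksub M sets_eq_imp_space_eq[OF M(2)]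
    by (intro integral_bind[where K=N and B="exp \<alpha> + 1" and B'=1] one)
      (auto cong: measurable_cong_sets simp: prob_space.finite_measure)
  \<comment> \<open>The mean of \<open>g j\<close> under \<open>m j\<close> is computed twice:
    before the channel with weight \<open>1 + F j\<close>, and after it with weight
    \<open>1 + g j\<close>. The unweighted terms vanish because \<open>g j\<close> has mean zero
    under \<open>m0\<close>.\<close>
  have FG: "integrable P (\<lambda>x. F j x * G j x)" and FGeq: "(\<integral>x. F j x * G j x \<partial>P) = (\<integral>z. (g j z)\<^sup>2 \<partial>m0)"
    if j: "j \<in> J" for j
  proof -
    have iG: "integrable P (G j)"
      using Gb[OF j] G[OF j] by (intro P.integrable_const_bound[of _ "exp \<alpha> + 1"]) auto
    have iG2: "integrable P (\<lambda>x. (G j x)\<^sup>2)"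
      using power_mono[OF Gb[OF j], of _ 2] G[OF j]
      by (intro P.integrable_const_bound[of _ "(exp \<alpha> + 1)\<^sup>2"]) auto
    show FG: "integrable P (\<lambda>x. F j x * G j x)"
      using j F2[OF j] iG2 by (auto intro: integrable_mult_of_squares)
    have "(\<integral>x. G j x \<partial>P) + (\<integral>x. F j x * G j x \<partial>P) = (\<integral>x. (1 + F j x) * G j x \<partial>P)"
      using iG FG by (simp add: distrib_right)
    also have "\<dots> = (\<integral>x. G j x \<partial>Pj j)"
      unfolding Pj_def using j F1[OF j]
      by (subst integral_density) auto
    also have "\<dots> = (\<integral>z. g j z \<partial>m j)"
      using j Pjp[OF j] Pjs by (simp add: m_def intb)
    also have "\<dots> = (\<integral>z. g j z + g j z * g j z \<partial>m0)"
      using j by (simp add: gm distrib_right)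
    also have "\<dots> = (\<integral>z. (g j z)\<^sup>2 \<partial>m0)"
      using gi[OF j] ggi[OF j j] g0[OF j] by (simp add: power2_eq_square)
    finally show "(\<integral>x. F j x * G j x \<partial>P) = (\<integral>z. (g j z)\<^sup>2 \<partial>m0)"
      using intb[OF j P refl] g0[OF j] by (simp add: m0_def)
  qed
  define S where "S = (\<Sum>j\<in>J. \<integral>z. (g j z)\<^sup>2 \<partial>m0)"
  define T where "T x = (\<Sum>j\<in>J. F j x * G j x)" for x
  have S: "(\<integral>x. T x \<partial>P) = S"
    unfolding T_def S_def using FG by (simp add: FGeq)
  have S0: "0 \<le> S"
    unfolding S_def by (intro sum_nonneg) auto
  have T[measurable]: "T \<in> borel_measurable P"
    unfolding T_def by measurable
  \<comment> \<open>The Gram matrix of the \<open>g j\<close> under \<open>m0\<close>; its trace is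
    \<open>S\<close>.\<close>
  define c where "c j k = (\<integral>z. g j z * g k z \<partial>m0)" for j k
  text \<open>\<open>T x\<close> is the integral under \<open>K x\<close> of a function \<open>H\<close> that has mean zero under \<open>m0\<close>, so privacy
    bounds it by \<open>exp \<alpha> - 1\<close> times the \<open>L\<^sup>1\<close> norm of \<open>H\<close> under \<open>m0\<close>.\<close>
  have TT: "(T x)\<^sup>2 \<le> (exp \<alpha> - 1)\<^sup>2 * (\<Sum>j\<in>J. \<Sum>k\<in>J. c j k * (F j x * F k x))" if x: "x \<in> space P" for x
  proof -
    interpret Kx: prob_space "K x" using x by (intro Kp)
    define H where "H z = (\<Sum>j\<in>J. F j x * g j z)" for z
    have gK: "integrable (K x) (g j)" if "j \<in> J" for j
      using gb[OF that] g(2)[OF that] Ks[OF x]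
      by (intro Kx.integrable_const_bound[of _ "exp \<alpha> + 1"]) (auto cong: measurable_cong_sets)
    have Tx: "T x = (\<integral>z. H z \<partial>K x)"
      unfolding T_def H_def G_def using gK by simp
    have H0: "(\<integral>z. H z \<partial>m0) = 0"
      unfolding H_def using gi by (simp add: g0)
    have Hm[measurable]: "H \<in> borel_measurable m0"
      unfolding H_def by measurable
    define B where "B = (\<Sum>j\<in>J. \<bar>F j x\<bar> * (exp \<alpha> + 1))"
    have HB: "\<bar>H z\<bar> \<le> B" for z
      unfolding H_def B_def using gb
      by (intro order_trans[OF sum_abs] sum_mono) (auto simp: abs_mult intro!: mult_left_mono)
    have Hi: "integrable m0 (\<lambda>z. \<bar>H z\<bar>)"
      using HB by (intro m0.integrable_const_bound[of _ B]) auto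
    have Hi2: "integrable m0 (\<lambda>z. (H z)\<^sup>2)"
      using power_mono[OF HB, of _ 2] by (intro m0.integrable_const_bound[of _ "B\<^sup>2"]) auto
    have "\<bar>T x\<bar> \<le> (exp \<alpha> - 1) * (\<integral>z. \<bar>H z\<bar> \<partial>m0)"
      unfolding Tx using Ks[OF x] Kle[OF x] Kge[OF x] HB H0 \<alpha>
      by (intro integral_close[OF m0p Kx.prob_space_axioms]) auto
    then have "\<bar>T x\<bar>\<^sup>2 \<le> ((exp \<alpha> - 1) * (\<integral>z. \<bar>H z\<bar> \<partial>m0))\<^sup>2"
      by (rule power_mono) simp
    also have "\<dots> = (exp \<alpha> - 1)\<^sup>2 * (\<integral>z. \<bar>H z\<bar> \<partial>m0)\<^sup>2"
      by (simp add: power_mult_distrib)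
    \<comment> \<open>Passing from the first to the second moment turns the bound into a quadratic
      form in the \<open>F j x\<close>, which can be integrated over \<open>x\<close> term by
      term.\<close>
    also have "(\<integral>z. \<bar>H z\<bar> \<partial>m0)\<^sup>2 \<le> (\<integral>z. (H z)\<^sup>2 \<partial>m0)"
      using Cauchy_Schwarz_integral[of "\<lambda>z. \<bar>H z\<bar>" m0 "\<lambda>_. 1"] Hi2 by (simp add: m0.prob_space)
    also have "(\<integral>z. (H z)\<^sup>2 \<partial>m0) = (\<integral>z. (\<Sum>j\<in>J. \<Sum>k\<in>J. (F j x * F k x) * (g j z * g k z)) \<partial>m0)"
      by (simp add: H_def power2_eq_square sum_product mult_ac)
    also have "\<dots> = (\<Sum>j\<in>J. \<Sum>k\<in>J. c j k * (F j x * F k x))"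
      using ggi by (simp add: c_def mult_ac)
    finally show ?thesis
      by (simp add: mult_left_mono)
  qed
  have iFF: "integrable P (\<lambda>x. F j x * F k x)" if "j \<in> J" "k \<in> J" for j k
    using that F2 by (auto intro: integrable_mult_of_squares)
  define R where "R x = (exp \<alpha> - 1)\<^sup>2 * (\<Sum>j\<in>J. \<Sum>k\<in>J. c j k * (F j x * F k x))" for x
  have iR: "integrable P R"
    unfolding R_def using iFF by simp
  have iT: "integrable P (\<lambda>x. (T x)\<^sup>2)"
    using TT by (intro Bochner_Integration.integrable_bound[OF iR]) (auto simp: R_def intro!: AE_I2 order_trans[OF _ abs_ge_self])
  have "S\<^sup>2 \<le> (\<integral>x. (T x)\<^sup>2 \<partial>P)"
    using Cauchy_Schwarz_integral[of T P "\<lambda>_. 1"] iT by (simp add: P.prob_space S)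
  also have "\<dots> \<le> (\<integral>x. R x \<partial>P)"
    by (rule integral_mono[OF iT iR]) (simp add: R_def TT)
  also have "\<dots> = (exp \<alpha> - 1)\<^sup>2 * (\<Sum>j\<in>J. \<Sum>k\<in>J. c j k * (\<integral>x. F j x * F k x \<partial>P))"
    unfolding R_def using iFF by simp
  \<comment> \<open>Orthogonality leaves the diagonal, that is, the trace of \<open>c\<close>
    weighted by the squared norms of the \<open>F j\<close>.\<close>
  also have "(\<Sum>j\<in>J. \<Sum>k\<in>J. c j k * (\<integral>x. F j x * F k x \<partial>P)) = (\<Sum>j\<in>J. c j j * (\<integral>x. (F j x)\<^sup>2 \<partial>P))"
  proof (intro sum.cong refl)
    fix j assume j: "j \<in> J"
    have "(\<Sum>k\<in>J. c j k * (\<integral>x. F j x * F k x \<partial>P)) =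
      (\<Sum>k\<in>J. if k = j then c j j * (\<integral>x. (F j x)\<^sup>2 \<partial>P) else 0)"
      using j orth by (intro sum.cong refl) (auto simp: power2_eq_square)
    then show "(\<Sum>k\<in>J. c j k * (\<integral>x. F j x * F k x \<partial>P)) = c j j * (\<integral>x. (F j x)\<^sup>2 \<partial>P)"
      using j J by simp
  qed
  also have "(\<Sum>j\<in>J. c j j * (\<integral>x. (F j x)\<^sup>2 \<partial>P)) \<le> S * v"
  proof -
    have "(\<Sum>j\<in>J. c j j * (\<integral>x. (F j x)\<^sup>2 \<partial>P)) \<le> (\<Sum>j\<in>J. c j j * v)"
      using v by (intro sum_mono mult_left_mono) (auto simp: c_def)
    then show ?thesis
      by (simp add: S_def c_def sum_distrib_right power2_eq_square)
  qed
  finally have "S\<^sup>2 \<le> (exp \<alpha> - 1)\<^sup>2 * (S * v)"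
    by (simp add: mult_left_mono)
  then have SS: "S * S \<le> S * ((exp \<alpha> - 1)\<^sup>2 * v)"
    by (simp add: power2_eq_square mult_ac)
  \<comment> \<open>One factor \<open>S\<close> cancels; if \<open>S\<close> vanishes, the bound is
    \<open>v0\<close>.\<close>
  have "S \<le> (exp \<alpha> - 1)\<^sup>2 * v"
  proof (cases "S = 0")
    case False
    with S0 SS show ?thesis
      by simp
  qed (use v0 in simp)
  then show ?thesis
    using r m_def Pj_def by (intro exI[of _ r]) (auto simp: m0_def[symmetric] S_def g_def)
qed

section \<open>Product measures and product kernels\<close>

text \<open>The locale \<open>product_prob_space\<close> speaks of a probability measure at every
  index of the type, so the family is filled up with point masses outside \<open>I\<close>, which
  leaves the product over \<open>I\<close> unchanged.\<close>

lemma PiM_eqI_prob_space: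
  assumes I: "finite I" and M: "\<And>i. i \<in> I \<Longrightarrow> prob_space (M i)"
    and sets: "sets P = sets (PiM I M)"
    and eq: "\<And>A. (\<And>i. i \<in> I \<Longrightarrow> A i \<in> sets (M i)) \<Longrightarrow>
      emeasure P (Pi\<^sub>E I A) = (\<Prod>i\<in>I. emeasure (M i) (A i))"
  shows "P = PiM I M"
proof -
  define M' where "M' i = (if i \<in> I then M i else return (count_space UNIV) undefined)" for i
  have PiM: "PiM I M' = PiM I M"
    by (intro PiM_cong) (simp_all add: M'_def)
  interpret M': product_prob_space M' I
    by (rule product_prob_spaceI) (auto simp: M'_def intro!: prob_space_return M)
  show ?thesis
    unfolding PiM[symmetric]
  proof (rule M'.PiM_eqI[OF I])
    show "sets P = sets (PiM I M')"
      using sets by (simp add: PiM)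
    show "emeasure P (Pi\<^sub>E I A) = (\<Prod>i\<in>I. emeasure (M' i) (A i))"
      if "\<And>i. i \<in> I \<Longrightarrow> A i \<in> sets (M' i)" for A
      using that by (subst eq) (auto simp: M'_def cong: prod.cong)
  qed
qed

lemma nn_integral_PiM_prod:
  assumes I: "finite I" and M: "\<And>i. i \<in> I \<Longrightarrow> prob_space (M i)"
    and f: "\<And>i. i \<in> I \<Longrightarrow> f i \<in> borel_measurable (M i)"
  shows "(\<integral>\<^sup>+x. (\<Prod>i\<in>I. f i (x i)) \<partial>PiM I M) = (\<Prod>i\<in>I. \<integral>\<^sup>+x. f i x \<partial>M i)"
proof -
  define M' where "M' i = (if i \<in> I then M i else return (count_space UNIV) undefined)" for i
  have PiM: "PiM I M' = PiM I M"
    by (intro PiM_cong) (simp_all add: M'_def)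
  interpret M': product_prob_space M' I
    by (rule product_prob_spaceI) (auto simp: M'_def intro!: prob_space_return M)
  show ?thesis
    using M'.product_nn_integral_prod[OF I, of f] f by (simp add: PiM) (simp add: M'_def cong: prod.cong)
qed

lemma emeasure_PiM_PiE:
  assumes I: "finite I" and M: "\<And>i. i \<in> I \<Longrightarrow> prob_space (M i)"
    and A: "\<And>i. i \<in> I \<Longrightarrow> A i \<in> sets (M i)"
  shows "emeasure (PiM I M) (Pi\<^sub>E I A) = (\<Prod>i\<in>I. emeasure (M i) (A i))"
proof -
  have "prod_emb I M I (Pi\<^sub>E I A) = Pi\<^sub>E I A"
    using A by (intro prod_emb_id) (auto dest: sets.sets_into_space)
  moreover have "emeasure (PiM I M) (prod_emb I M I (Pi\<^sub>E I A)) = (\<Prod>i\<in>I. emeasure (M i) (A i))"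
    by (intro emeasure_PiM_emb M A I subset_refl)
  ultimately show ?thesis
    by simp
qed

text \<open>The indicator of a rectangle is a product of indicators, so the mass that the product
  density gives to a rectangle factorizes; rectangles determine the product measure.\<close>

lemma PiM_density:
  assumes I: "finite I" and M: "\<And>i. i \<in> I \<Longrightarrow> prob_space (M i)"
    and r[measurable]: "\<And>i. i \<in> I \<Longrightarrow> r i \<in> borel_measurable (M i)"
    and D: "\<And>i. i \<in> I \<Longrightarrow> prob_space (density (M i) (r i))"
  shows "PiM I (\<lambda>i. density (M i) (r i)) = density (PiM I M) (\<lambda>x. \<Prod>i\<in>I. r i (x i))"
proof (rule PiM_eqI_prob_space[OF I D, symmetric])
  show "sets (density (PiM I M) (\<lambda>x. \<Prod>i\<in>I. r i (x i))) = sets (PiM I (\<lambda>i. density (M i) (r i)))"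
    by (subst sets_density, rule sets_PiM_cong) auto
  fix A assume "\<And>i. i \<in> I \<Longrightarrow> A i \<in> sets (density (M i) (r i))"
  then have A[measurable]: "\<And>i. i \<in> I \<Longrightarrow> A i \<in> sets (M i)"
    by simp
  have PiE[measurable]: "Pi\<^sub>E I A \<in> sets (PiM I M)"
    using I A by (rule sets_PiM_I_finite)
  have "emeasure (density (PiM I M) (\<lambda>x. \<Prod>i\<in>I. r i (x i))) (Pi\<^sub>E I A) =
    (\<integral>\<^sup>+x. (\<Prod>i\<in>I. r i (x i)) * indicator (Pi\<^sub>E I A) x \<partial>PiM I M)"
    by (rule emeasure_density) (use PiE in measurable)
  also have "\<dots> = (\<integral>\<^sup>+x. (\<Prod>i\<in>I. r i (x i) * indicator (A i) (x i)) \<partial>PiM I M)"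
  proof (rule nn_integral_cong)
    fix x assume x: "x \<in> space (PiM I M)"
    show "(\<Prod>i\<in>I. r i (x i)) * indicator (Pi\<^sub>E I A) x = (\<Prod>i\<in>I. r i (x i) * indicator (A i) (x i))"
    proof (cases "x \<in> Pi\<^sub>E I A")
      case True
      then show ?thesis
        by (auto simp: PiE_iff intro!: prod.cong)
    next
      case False
      then obtain i where "i \<in> I" "x i \<notin> A i"
        using x by (auto simp: space_PiM PiE_iff)
      then have "(\<Prod>i\<in>I. r i (x i) * indicator (A i) (x i)) = 0"
        using I by (intro prod_zero bexI[of _ i]) auto
      with False show ?thesis
        by simp
    qed
  qed
  also have "\<dots> = (\<Prod>i\<in>I. \<integral>\<^sup>+x. r i x * indicator (A i) x \<partial>M i)"
    by (rule nn_integral_PiM_prod[OF I M]) auto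
  also have "\<dots> = (\<Prod>i\<in>I. emeasure (density (M i) (r i)) (A i))"
    by (intro prod.cong refl) (simp add: emeasure_density)
  finally show "emeasure (density (PiM I M) (\<lambda>x. \<Prod>i\<in>I. r i (x i))) (Pi\<^sub>E I A) =
    (\<Prod>i\<in>I. emeasure (density (M i) (r i)) (A i))" .
qed

text \<open>It is enough to test on the generating cylinders, whose mass is a finite product of
  masses that each depend measurably on one coordinate.\<close>

lemma measurable_PiM_kernel:
  assumes I: "finite I" and K: "\<And>i. i \<in> I \<Longrightarrow> K i \<in> M i \<rightarrow>\<^sub>M prob_algebra (N i)"
  shows "(\<lambda>x. \<Pi>\<^sub>M i\<in>I. K i (x i)) \<in> PiM I M \<rightarrow>\<^sub>M prob_algebra (PiM I N)"
proof (rule measurable_prob_algebra_generated[OF sets_PiM Int_stable_prod_algebra prod_algebra_sets_into_space])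
  have Kx: "prob_space (K i (x i))" "sets (K i (x i)) = sets (N i)"
    if "x \<in> space (PiM I M)" "i \<in> I" for x i
    using that measurable_space[OF K, of i "x i"] by (auto simp: space_prob_algebra space_PiM PiE_iff)
  fix x assume x: "x \<in> space (PiM I M)"
  show "prob_space (\<Pi>\<^sub>M i\<in>I. K i (x i))"
    using Kx[OF x] by (intro prob_space_PiM)
  show "sets (\<Pi>\<^sub>M i\<in>I. K i (x i)) = sets (PiM I N)"
    using Kx[OF x] by (intro sets_PiM_cong) auto
next
  have Kx: "prob_space (K i (x i))" "sets (K i (x i)) = sets (N i)"
    if "x \<in> space (PiM I M)" "i \<in> I" for x i
    using that measurable_space[OF K, of i "x i"] by (auto simp: space_prob_algebra space_PiM PiE_iff)
  fix A assume "A \<in> prod_algebra I N"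
  then obtain J E where A: "A = prod_emb I N J (Pi\<^sub>E J E)" and J: "finite J" "J \<subseteq> I"
    and E: "\<And>i. i \<in> J \<Longrightarrow> E i \<in> sets (N i)"
    by (elim prod_algebraE) blast
  have eq: "emeasure (\<Pi>\<^sub>M i\<in>I. K i (x i)) A = (\<Prod>i\<in>J. emeasure (K i (x i)) (E i))"
    if x: "x \<in> space (PiM I M)" for x
  proof -
    \<comment> \<open>The embedding depends on the factor measures only through their spaces, so the
      cylinder can be read with respect to the kernels at \<open>x\<close>.\<close>
    have "A = prod_emb I (\<lambda>i. K i (x i)) J (Pi\<^sub>E J E)"
      using sets_eq_imp_space_eq[OF Kx(2)[OF x]] by (simp add: A prod_emb_def cong: PiE_cong)
    then show ?thesis
      using Kx[OF x] J E by (auto intro!: emeasure_PiM_emb)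
  qed
  have "(\<lambda>x. emeasure (K i (x i)) (E i)) \<in> borel_measurable (PiM I M)" if "i \<in> J" for i
  proof -
    have [measurable]: "K i \<in> M i \<rightarrow>\<^sub>M subprob_algebra (N i)" "E i \<in> sets (N i)" "i \<in> I"
      using that J E K by (auto intro: measurable_prob_algebraD)
    show ?thesis
      by measurable
  qed
  then have "(\<lambda>x. \<Prod>i\<in>J. emeasure (K i (x i)) (E i)) \<in> borel_measurable (PiM I M)"
    by (intro borel_measurable_prod_ennreal)
  then show "(\<lambda>x. emeasure (\<Pi>\<^sub>M i\<in>I. K i (x i)) A) \<in> borel_measurable (PiM I M)"
    by (simp add: eq cong: measurable_cong)
qed

text \<open>Independent inputs sent through separate channels have independent outputs: on a
  rectangle the kernel mass is a product of functions of single inputs, and its integral factorizes.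
  This makes \<open>privatized_law\<close> a product over the observations.\<close>

lemma bind_PiM_kernel:
  assumes I: "finite I" and P: "\<And>i. i \<in> I \<Longrightarrow> prob_space (P i)"
    and K: "\<And>i. i \<in> I \<Longrightarrow> K i \<in> P i \<rightarrow>\<^sub>M prob_algebra (N i)"
  shows "PiM I P \<bind> (\<lambda>x. \<Pi>\<^sub>M i\<in>I. K i (x i)) = (\<Pi>\<^sub>M i\<in>I. P i \<bind> K i)"
proof -
  have Pi: "P i \<in> space (prob_algebra (P i))" if "i \<in> I" for i
    using that by (simp add: space_prob_algebra P)
  have PP: "PiM I P \<in> space (prob_algebra (PiM I P))"
    by (simp add: space_prob_algebra prob_space_PiM P)
  have KK: "(\<lambda>x. \<Pi>\<^sub>M i\<in>I. K i (x i)) \<in> PiM I P \<rightarrow>\<^sub>M prob_algebra (PiM I N)"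
    by (rule measurable_PiM_kernel[OF I K])
  have sets_i: "sets (P i \<bind> K i) = sets (N i)" if "i \<in> I" for i
    by (rule sets_bind'[OF Pi K]) (use that in auto)
  have Kx: "prob_space (K i (x i))" "sets (K i (x i)) = sets (N i)"
    if "x \<in> space (PiM I P)" "i \<in> I" for x i
    using that measurable_space[OF K, of i "x i"] by (auto simp: space_prob_algebra space_PiM PiE_iff)
  show ?thesis
  proof (rule PiM_eqI_prob_space[OF I])
    show "prob_space (P i \<bind> K i)" if "i \<in> I" for i
      by (rule prob_space_bind'[OF Pi K]) (use that in auto)
    show "sets (PiM I P \<bind> (\<lambda>x. \<Pi>\<^sub>M i\<in>I. K i (x i))) = sets (\<Pi>\<^sub>M i\<in>I. P i \<bind> K i)"
      unfolding sets_bind'[OF PP KK] by (intro sets_PiM_cong) (auto simp: sets_i)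
    fix A assume "\<And>i. i \<in> I \<Longrightarrow> A i \<in> sets (P i \<bind> K i)"
    then have A: "A i \<in> sets (N i)" if "i \<in> I" for i
      using that by (simp add: sets_i)
    have "emeasure (PiM I P \<bind> (\<lambda>x. \<Pi>\<^sub>M i\<in>I. K i (x i))) (Pi\<^sub>E I A) =
      (\<integral>\<^sup>+x. emeasure (\<Pi>\<^sub>M i\<in>I. K i (x i)) (Pi\<^sub>E I A) \<partial>PiM I P)"
      using I A by (intro emeasure_bind_prob_algebra[OF PP KK] sets_PiM_I_finite) auto
    also have "\<dots> = (\<integral>\<^sup>+x. (\<Prod>i\<in>I. emeasure (K i (x i)) (A i)) \<partial>PiM I P)"
      using A Kx by (intro nn_integral_cong emeasure_PiM_PiE I) auto
    also have "\<dots> = (\<Prod>i\<in>I. \<integral>\<^sup>+x. emeasure (K i x) (A i) \<partial>P i)"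
    proof (rule nn_integral_PiM_prod[OF I P])
      fix i assume i: "i \<in> I"
      have [measurable]: "K i \<in> P i \<rightarrow>\<^sub>M subprob_algebra (N i)" "A i \<in> sets (N i)"
        using i A K by (auto intro: measurable_prob_algebraD)
      show "(\<lambda>x. emeasure (K i x) (A i)) \<in> borel_measurable (P i)"
        by measurable
    qed
    also have "\<dots> = (\<Prod>i\<in>I. emeasure (P i \<bind> K i) (A i))"
      by (intro prod.cong refl emeasure_bind_prob_algebra[OF Pi K, symmetric] A)
    finally show "emeasure (PiM I P \<bind> (\<lambda>x. \<Pi>\<^sub>M i\<in>I. K i (x i))) (Pi\<^sub>E I A) =
      (\<Prod>i\<in>I. emeasure (P i \<bind> K i) (A i))" .
  qed
qed

text \<open>Cauchy-Schwarz is applied to the product density and the indicator of \<open>A\<close>.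
  The second moment of the product density factorizes; each factor is one plus a chi-square
  divergence \<open>y\<close>, and \<open>1 + y \<le> exp y\<close>.\<close>

lemma measure_PiM_density_square_le:
  fixes r :: "'i \<Rightarrow> 'a \<Rightarrow> real"
  assumes I: "finite I" and M: "\<And>i. i \<in> I \<Longrightarrow> prob_space (M i)"
    and r[measurable]: "\<And>i. i \<in> I \<Longrightarrow> r i \<in> borel_measurable (M i)"
    and r0: "\<And>i x. i \<in> I \<Longrightarrow> 0 \<le> r i x"
    and r2: "\<And>i. i \<in> I \<Longrightarrow> integrable (M i) (\<lambda>x. (r i x)\<^sup>2)"
    and D: "\<And>i. i \<in> I \<Longrightarrow> prob_space (density (M i) (\<lambda>x. ennreal (r i x)))"
    and A[measurable]: "A \<in> sets (PiM I M)"
  shows "(measure (\<Pi>\<^sub>M i\<in>I. density (M i) (\<lambda>x. ennreal (r i x))) A)\<^sup>2 \<le>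
    measure (PiM I M) A * exp (\<Sum>i\<in>I. \<integral>x. (r i x - 1)\<^sup>2 \<partial>M i)"
proof -
  let ?D = "\<Pi>\<^sub>M i\<in>I. density (M i) (\<lambda>x. ennreal (r i x))"
  interpret P: prob_space "PiM I M" by (intro prob_space_PiM M)
  interpret D: prob_space ?D by (intro prob_space_PiM D)
  have moment: "(\<integral>\<^sup>+x. (ennreal (r i x))\<^sup>2 \<partial>M i) \<le> ennreal (exp (\<integral>x. (r i x - 1)\<^sup>2 \<partial>M i))"
    if i: "i \<in> I" for i
  proof -
    interpret Mi: prob_space "M i" by (rule M[OF i])
    interpret Di: prob_space "density (M i) (\<lambda>x. ennreal (r i x))" by (rule D[OF i])
    have ri: "integrable (M i) (r i)"
      using r[OF i] r2[OF i] by (rule Mi.square_integrable_imp_integrable)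
    have "(\<integral>x. r i x \<partial>M i) = (\<integral>x. 1 \<partial>density (M i) (\<lambda>x. ennreal (r i x)))"
      using i r0 by (subst integral_density) auto
    also have "\<dots> = 1"
      using Di.prob_space by simp
    finally have "(\<integral>x. (r i x - 1)\<^sup>2 \<partial>M i) = (\<integral>x. (r i x)\<^sup>2 \<partial>M i) - 1"
      using ri r2[OF i] by (simp add: power2_diff Mi.prob_space)
    then have "(\<integral>x. (r i x)\<^sup>2 \<partial>M i) \<le> exp (\<integral>x. (r i x - 1)\<^sup>2 \<partial>M i)"
      using exp_ge_add_one_self[of "\<integral>x. (r i x - 1)\<^sup>2 \<partial>M i"] by simp
    moreover have "(\<integral>\<^sup>+x. (ennreal (r i x))\<^sup>2 \<partial>M i) = ennreal (\<integral>x. (r i x)\<^sup>2 \<partial>M i)"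
      using r0[OF i] r2[OF i] by (simp add: ennreal_power nn_integral_eq_integral)
    ultimately show ?thesis
      by (simp add: ennreal_leI)
  qed
  have "emeasure ?D A = (\<integral>\<^sup>+x. (\<Prod>i\<in>I. ennreal (r i (x i))) * indicator A x \<partial>PiM I M)"
    by (subst PiM_density[OF I M _ D]) (auto intro!: emeasure_density)
  then have "(emeasure ?D A)\<^sup>2 \<le>
    (\<integral>\<^sup>+x. (\<Prod>i\<in>I. ennreal (r i (x i)))\<^sup>2 \<partial>PiM I M) * (\<integral>\<^sup>+x. (indicator A x)\<^sup>2 \<partial>PiM I M)"
    by (simp only:) (rule Cauchy_Schwarz_nn_integral; measurable)
  also have "(\<integral>\<^sup>+x. (indicator A x)\<^sup>2 \<partial>PiM I M) = emeasure (PiM I M) A"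
  proof -
    have "(\<integral>\<^sup>+x. (indicator A x)\<^sup>2 \<partial>PiM I M) = (\<integral>\<^sup>+x. indicator A x \<partial>PiM I M)"
      by (intro nn_integral_cong) (simp add: indicator_def)
    then show ?thesis
      by simp
  qed
  also have "(\<integral>\<^sup>+x. (\<Prod>i\<in>I. ennreal (r i (x i)))\<^sup>2 \<partial>PiM I M) =
    (\<integral>\<^sup>+x. (\<Prod>i\<in>I. (ennreal (r i (x i)))\<^sup>2) \<partial>PiM I M)"
    by (simp add: prod_power_distrib)
  also have "\<dots> = (\<Prod>i\<in>I. \<integral>\<^sup>+x. (ennreal (r i x))\<^sup>2 \<partial>M i)"
    by (rule nn_integral_PiM_prod[OF I M]) auto
  also have "(\<Prod>i\<in>I. \<integral>\<^sup>+x. (ennreal (r i x))\<^sup>2 \<partial>M i) * emeasure (PiM I M) A \<le>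
    (\<Prod>i\<in>I. ennreal (exp (\<integral>x. (r i x - 1)\<^sup>2 \<partial>M i))) * emeasure (PiM I M) A"
    by (intro mult_right_mono prod_mono_ennreal moment) auto
  also have "\<dots> = ennreal (measure (PiM I M) A * exp (\<Sum>i\<in>I. \<integral>x. (r i x - 1)\<^sup>2 \<partial>M i))"
    by (simp add: prod_ennreal exp_sum I P.emeasure_eq_measure ennreal_mult' mult.commute)
  finally show ?thesis
    by (simp add: D.emeasure_eq_measure ennreal_power)
qed

section \<open>The noise distribution\<close>

lemma nn_integral_lborel_shift:
  fixes f :: "real \<Rightarrow> ennreal"
  assumes "f \<in> borel_measurable borel"
  shows "(\<integral>\<^sup>+x. f (x + t) \<partial>lborel) = (\<integral>\<^sup>+x. f x \<partial>lborel)"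
  using nn_integral_real_affine[OF assms, of 1 t] by (simp add: add.commute)

text \<open>The curvature bound at the midpoint of \<open>x\<close> and \<open>x - 2 * t\<close> gives
  \<open>p (x - t)\<^sup>2 / p x \<le> exp (C * t\<^sup>2) * p (x - 2 * t)\<close>, and the right-hand side integrates to
  \<open>exp (C * t\<^sup>2)\<close>.\<close>

lemma noise_law_shift_density:
  assumes \<nu>: "noise_law c C \<nu>"
  obtains u :: "real \<Rightarrow> real" where "u \<in> borel_measurable borel" "\<And>x. 0 \<le> u x"
    "distr \<nu> borel (\<lambda>x. x + t) = density \<nu> (\<lambda>x. ennreal (u x))"
    "(\<integral>\<^sup>+x. (ennreal (u x))\<^sup>2 \<partial>\<nu>) \<le> ennreal (exp (C * t\<^sup>2))"
proof -
  interpret prob_space \<nu>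
    using \<nu> by (simp add: noise_law_def)
  obtain p \<phi>\<^sub>0 where dens: "\<nu> = density lborel (\<lambda>x. ennreal (p x))"
    and curv: "curvature_bounded_above C (\<lambda>x. - ln (p x))"
    and conv: "convex_on UNIV \<phi>\<^sub>0" and p: "\<And>x. p x = exp (- \<phi>\<^sub>0 x) * exp (- c * x\<^sup>2 / 2)"
    using \<nu> unfolding noise_law_def strongly_log_concave_def by blast
  have p0: "0 < p x" for x
    by (simp add: p)
  \<comment> \<open>Measurability of \<open>p\<close> comes from convexity: a finite convex function
    on the line is continuous.\<close>
  have [measurable]: "\<phi>\<^sub>0 \<in> borel_measurable borel"
    using convex_on_continuous[OF open_UNIV conv] by (rule borel_measurable_continuous_onI)
  have pm[measurable]: "p \<in> borel_measurable borel"
    unfolding p by measurable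
  define u where "u x = p (x - t) / p x" for x
  have um[measurable]: "u \<in> borel_measurable borel"
    unfolding u_def by measurable
  have u0: "0 \<le> u x" for x
    using p0 by (simp add: u_def less_imp_le)
  have pu: "ennreal (p x) * ennreal (u x) = ennreal (p (x - t))" for x
    using p0[of x] u0[of x] by (simp add: ennreal_mult'[symmetric] u_def)
  have key: "p x * (u x)\<^sup>2 \<le> exp (C * t\<^sup>2) * p (x - 2 * t)" for x
  proof -
    have "- (C / 2) * (1 / 2) * (1 - 1 / 2) * (x - (x - 2 * t))\<^sup>2 \<le>
      - ln (p (1 / 2 * x + (1 - 1 / 2) * (x - 2 * t))) - (1 / 2 * - ln (p x) + (1 - 1 / 2) * - ln (p (x - 2 * t)))"
      by (intro curv[unfolded curvature_bounded_above_def, rule_format]) simp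
    moreover have "1 / 2 * x + (1 - 1 / 2) * (x - 2 * t) = x - t"
      by (simp add: field_simps)
    ultimately have "- (C / 2) * (1 / 2) * (1 - 1 / 2) * (x - (x - 2 * t))\<^sup>2 \<le>
      - ln (p (x - t)) - (1 / 2 * - ln (p x) + (1 - 1 / 2) * - ln (p (x - 2 * t)))"
      by (simp only:)
    then have "2 * ln (p (x - t)) \<le> C * t\<^sup>2 + ln (p x) + ln (p (x - 2 * t))"
      by (simp add: field_simps power2_eq_square)
    then have "exp (2 * ln (p (x - t))) \<le> exp (C * t\<^sup>2 + ln (p x) + ln (p (x - 2 * t)))"
      by simp
    then have "(p (x - t))\<^sup>2 \<le> exp (C * t\<^sup>2) * p x * p (x - 2 * t)"
      using p0 by (simp add: exp_add exp_double)
    then show ?thesis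
      using p0[of x] by (simp add: u_def power2_eq_square field_simps)
  qed
  show ?thesis
  proof
    show "distr \<nu> borel (\<lambda>x. x + t) = density \<nu> (\<lambda>x. ennreal (u x))"
    proof (rule measure_eqI)
      fix A assume "A \<in> sets (distr \<nu> borel (\<lambda>x. x + t))"
      then have A[measurable]: "A \<in> sets borel"
        by simp
      have "emeasure (distr \<nu> borel (\<lambda>x. x + t)) A = (\<integral>\<^sup>+x. indicator A x \<partial>distr \<nu> borel (\<lambda>x. x + t))"
        by simp
      also have "\<dots> = (\<integral>\<^sup>+x. indicator A (x + t) \<partial>\<nu>)"
        by (rule nn_integral_distr) (simp_all add: dens)
      also have "\<dots> = (\<integral>\<^sup>+x. ennreal (p (x + t - t)) * indicator A (x + t) \<partial>lborel)"
        unfolding dens by (subst nn_integral_density) auto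
      also have "\<dots> = (\<integral>\<^sup>+x. ennreal (p (x - t)) * indicator A x \<partial>lborel)"
        by (rule nn_integral_lborel_shift[of "\<lambda>x. ennreal (p (x - t)) * indicator A x"]) measurable
      also have "\<dots> = (\<integral>\<^sup>+x. ennreal (p x) * (ennreal (u x) * indicator A x) \<partial>lborel)"
        by (simp add: pu[symmetric] mult.assoc)
      also have "\<dots> = (\<integral>\<^sup>+x. ennreal (u x) * indicator A x \<partial>\<nu>)"
        unfolding dens by (subst nn_integral_density) auto
      also have "\<dots> = emeasure (density \<nu> (\<lambda>x. ennreal (u x))) A"
        by (subst emeasure_density) (auto simp: dens)
      finally show "emeasure (distr \<nu> borel (\<lambda>x. x + t)) A = emeasure (density \<nu> (\<lambda>x. ennreal (u x))) A" .
    qed (simp add: dens)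
    have "(\<integral>\<^sup>+x. (ennreal (u x))\<^sup>2 \<partial>\<nu>) = (\<integral>\<^sup>+x. ennreal (p x * (u x)\<^sup>2) \<partial>lborel)"
      unfolding dens using p0 u0
      by (subst nn_integral_density) (auto simp: ennreal_mult' ennreal_power less_imp_le intro!: nn_integral_cong)
    also have "\<dots> \<le> (\<integral>\<^sup>+x. ennreal (exp (C * t\<^sup>2)) * ennreal (p (x + - (2 * t))) \<partial>lborel)"
      using key by (intro nn_integral_mono) (simp add: ennreal_mult'[symmetric] ennreal_leI)
    also have "\<dots> = ennreal (exp (C * t\<^sup>2)) * (\<integral>\<^sup>+x. ennreal (p x) \<partial>lborel)"
      by (subst nn_integral_cmult) (auto simp: nn_integral_lborel_shift[of "\<lambda>x. ennreal (p x)"] simp del: add_uminus_conv_diff)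
    also have "(\<integral>\<^sup>+x. ennreal (p x) \<partial>lborel) = 1"
      using emeasure_space_1 by (simp add: dens emeasure_density)
    finally show "(\<integral>\<^sup>+x. (ennreal (u x))\<^sup>2 \<partial>\<nu>) \<le> ennreal (exp (C * t\<^sup>2))"
      by simp
  qed (use um u0 in auto)
qed

text \<open>Since \<open>b + \<sigma> * x = \<sigma> * (x + b / \<sigma>)\<close>, rescaling reduces
  this to \<open>noise_law_shift_density\<close> at the shift \<open>b / \<sigma>\<close>. The base
  law keeps the summand 0 so that it matches a null coordinate of \<open>shift_law\<close>.\<close>

lemma noise_law_location_density:
  fixes \<sigma> b :: real
  assumes \<nu>: "noise_law c C \<nu>" and \<sigma>: "0 < \<sigma>"
  defines "\<nu>\<^sub>0 \<equiv> distr \<nu> borel (\<lambda>x. 0 + \<sigma> * x)"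
  obtains w :: "real \<Rightarrow> real" where "w \<in> borel_measurable borel" "\<And>y. 0 \<le> w y"
    "distr \<nu> borel (\<lambda>x. b + \<sigma> * x) = density \<nu>\<^sub>0 (\<lambda>y. ennreal (w y))"
    "integrable \<nu>\<^sub>0 (\<lambda>y. (w y)\<^sup>2)" "(\<integral>y. w y \<partial>\<nu>\<^sub>0) = 1"
    "(\<integral>y. (w y - 1)\<^sup>2 \<partial>\<nu>\<^sub>0) \<le> exp (C * (b / \<sigma>)\<^sup>2) - 1"
proof -
  interpret \<nu>: prob_space \<nu>
    using \<nu> by (simp add: noise_law_def)
  have [measurable_cong, simp]: "sets \<nu> = sets borel"
    using \<nu> by (auto simp: noise_law_def)
  interpret \<nu>0: prob_space \<nu>\<^sub>0
    unfolding \<nu>\<^sub>0_def by (rule \<nu>.prob_space_distr) simp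
  interpret \<nu>b: prob_space "distr \<nu> borel (\<lambda>x. b + \<sigma> * x)"
    by (rule \<nu>.prob_space_distr) simp
  obtain u where u[measurable]: "u \<in> borel_measurable borel" and u0: "\<And>x. 0 \<le> u x"
    and ud: "distr \<nu> borel (\<lambda>x. x + b / \<sigma>) = density \<nu> (\<lambda>x. ennreal (u x))"
    and u2: "(\<integral>\<^sup>+x. (ennreal (u x))\<^sup>2 \<partial>\<nu>) \<le> ennreal (exp (C * (b / \<sigma>)\<^sup>2))"
    using noise_law_shift_density[OF \<nu>] by metis
  define w where "w y = u (y / \<sigma>)" for y
  have w[measurable]: "w \<in> borel_measurable borel"
    unfolding w_def by measurable
  have w0: "0 \<le> w y" for y
    by (simp add: w_def u0)
  have dens: "distr \<nu> borel (\<lambda>x. b + \<sigma> * x) = density \<nu>\<^sub>0 (\<lambda>y. ennreal (w y))"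
  proof (rule measure_eqI)
    fix A assume "A \<in> sets (distr \<nu> borel (\<lambda>x. b + \<sigma> * x))"
    then have A[measurable]: "A \<in> sets borel"
      by simp
    have "emeasure (distr \<nu> borel (\<lambda>x. b + \<sigma> * x)) A = (\<integral>\<^sup>+x. indicator A (\<sigma> * (x + b / \<sigma>)) \<partial>\<nu>)"
      using \<sigma> by (subst nn_integral_indicator[symmetric])
        (simp_all add: nn_integral_distr distrib_left add.commute del: nn_integral_indicator)
    also have "\<dots> = (\<integral>\<^sup>+x. indicator A (\<sigma> * x) \<partial>distr \<nu> borel (\<lambda>x. x + b / \<sigma>))"
      by (subst nn_integral_distr) auto
    also have "\<dots> = (\<integral>\<^sup>+x. ennreal (u x) * indicator A (\<sigma> * x) \<partial>\<nu>)"
      unfolding ud by (subst nn_integral_density) auto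
    also have "\<dots> = (\<integral>\<^sup>+y. ennreal (w y) * indicator A y \<partial>\<nu>\<^sub>0)"
      using \<sigma> unfolding \<nu>\<^sub>0_def by (subst nn_integral_distr) (auto simp: w_def)
    also have "\<dots> = emeasure (density \<nu>\<^sub>0 (\<lambda>y. ennreal (w y))) A"
      by (subst emeasure_density) (auto simp: \<nu>\<^sub>0_def)
    finally show "emeasure (distr \<nu> borel (\<lambda>x. b + \<sigma> * x)) A = emeasure (density \<nu>\<^sub>0 (\<lambda>y. ennreal (w y))) A" .
  qed (simp add: \<nu>\<^sub>0_def)
  have [measurable]: "w \<in> borel_measurable \<nu>\<^sub>0"
    by (simp add: \<nu>\<^sub>0_def)
  have nn: "(\<integral>\<^sup>+y. ennreal ((w y)\<^sup>2) \<partial>\<nu>\<^sub>0) \<le> ennreal (exp (C * (b / \<sigma>)\<^sup>2))"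
    using u2 \<sigma> u0 unfolding \<nu>\<^sub>0_def by (subst nn_integral_distr) (auto simp: w_def ennreal_power)
  have w2: "integrable \<nu>\<^sub>0 (\<lambda>y. (w y)\<^sup>2)"
    by (rule integrableI_nonneg) (auto intro: le_less_trans[OF nn])
  have w1: "integrable \<nu>\<^sub>0 w"
    using w2 by (intro \<nu>0.square_integrable_imp_integrable[where f=w]) auto
  have "ennreal (\<integral>y. (w y)\<^sup>2 \<partial>\<nu>\<^sub>0) \<le> ennreal (exp (C * (b / \<sigma>)\<^sup>2))"
    using nn w2 by (simp add: nn_integral_eq_integral)
  then have le: "(\<integral>y. (w y)\<^sup>2 \<partial>\<nu>\<^sub>0) \<le> exp (C * (b / \<sigma>)\<^sup>2)"
    by simp
  have "(\<integral>y. w y \<partial>\<nu>\<^sub>0) = (\<integral>y. 1 \<partial>distr \<nu> borel (\<lambda>x. b + \<sigma> * x))"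
    unfolding dens using w0 by (subst integral_density) auto
  also have "\<dots> = 1"
    using \<nu>b.prob_space by simp
  finally have one: "(\<integral>y. w y \<partial>\<nu>\<^sub>0) = 1" .
  show ?thesis
  proof
    show "(\<integral>y. (w y - 1)\<^sup>2 \<partial>\<nu>\<^sub>0) \<le> exp (C * (b / \<sigma>)\<^sup>2) - 1"
      using w1 w2 one le by (simp add: power2_diff \<nu>0.prob_space)
  qed (use w w0 dens w2 one in auto)
qed

text \<open>The Chapman--Robbins inequality for the unit variance noise at shift \<open>1\<close>.\<close>

lemma noise_law_curvature_ge:
  assumes \<nu>: "noise_law c C \<nu>"
  shows "1 \<le> exp C - 1"
proof -
  interpret \<nu>: prob_space \<nu>
    using \<nu> by (simp add: noise_law_def)
  have [measurable_cong, simp]: "sets \<nu> = sets borel"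
    using \<nu> by (auto simp: noise_law_def)
  \<comment> \<open>At scale 1 the base law of \<open>noise_law_location_density\<close> is the
    noise law itself.\<close>
  have id: "distr \<nu> borel (\<lambda>x. 0 + 1 * x) = \<nu>"
    by (simp add: distr_id2)
  obtain w where w[measurable]: "w \<in> borel_measurable borel" and w0: "\<And>y. 0 \<le> w y"
    and wd: "distr \<nu> borel (\<lambda>x. 1 + 1 * x) = density \<nu> (\<lambda>y. ennreal (w y))"
    and w2: "integrable \<nu> (\<lambda>y. (w y)\<^sup>2)" and w1: "(\<integral>y. w y \<partial>\<nu>) = 1"
    and chi: "(\<integral>y. (w y - 1)\<^sup>2 \<partial>\<nu>) \<le> exp (C * (1 / 1)\<^sup>2) - 1"
    using noise_law_location_density[OF \<nu> zero_less_one, of 1] unfolding id by metis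
  define \<mu> where "\<mu> = (\<integral>x. x \<partial>\<nu>)"
  have var: "(\<integral>x. (x - \<mu>)\<^sup>2 \<partial>\<nu>) = 1"
    using \<nu> by (simp add: noise_law_def \<mu>_def)
  \<comment> \<open>The Bochner integral of a function that is not integrable is 0, so the value 1
    certifies a finite second moment.\<close>
  then have x2: "integrable \<nu> (\<lambda>x. (x - \<mu>)\<^sup>2)"
    using not_integrable_integral_eq by fastforce
  then have xm: "integrable \<nu> (\<lambda>x. x - \<mu>)"
    by (intro \<nu>.square_integrable_imp_integrable[where f="\<lambda>x. x - \<mu>"]) auto
  then have "integrable \<nu> (\<lambda>x. (x - \<mu>) + \<mu>)"
    by (intro Bochner_Integration.integrable_add) auto
  then have x1: "integrable \<nu> (\<lambda>x. x)"
    by simp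
  have wi: "integrable \<nu> w"
    using w2 by (intro \<nu>.square_integrable_imp_integrable[where f=w]) auto
  have wx: "integrable \<nu> (\<lambda>x. w x * (x - \<mu>))"
    using w2 x2 by (intro integrable_mult_of_squares[where f=w and g="\<lambda>x. x - \<mu>"]) auto
  have wm: "integrable \<nu> (\<lambda>x. (w x - 1)\<^sup>2)"
    using wi w2 by (simp add: power2_diff)
  \<comment> \<open>The shift raises the mean by 1, so \<open>w - 1\<close> and
    \<open>x - \<mu>\<close> have inner product 1.\<close>
  have "(\<integral>x. w x * (x - \<mu>) \<partial>\<nu>) = (\<integral>x. x - \<mu> \<partial>distr \<nu> borel (\<lambda>x. 1 + 1 * x))"
    unfolding wd using w0 by (subst integral_density) auto
  also have "\<dots> = (\<integral>x. 1 + x - \<mu> \<partial>\<nu>)"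
    by (subst integral_distr) auto
  also have "\<dots> = 1"
    using x1 by (simp add: \<mu>_def \<nu>.prob_space)
  finally have "(\<integral>x. (w x - 1) * (x - \<mu>) \<partial>\<nu>) = 1"
    using wx xm x1 by (simp add: left_diff_distrib \<mu>_def \<nu>.prob_space)
  then have "1 \<le> (\<integral>x. (w x - 1)\<^sup>2 \<partial>\<nu>) * (\<integral>x. (x - \<mu>)\<^sup>2 \<partial>\<nu>)"
    using Cauchy_Schwarz_integral[of "\<lambda>x. w x - 1" \<nu> "\<lambda>x. x - \<mu>"] wm x2 by simp
  then show ?thesis
    using chi var by simp
qed

section \<open>Detection of a single spike\<close>

text \<open>The alternatives to the null vector; the restriction is there because members of
  \<open>sparse_class\<close> are extensional.\<close>

definition spike :: "nat \<Rightarrow> nat \<Rightarrow> real \<Rightarrow> nat \<Rightarrow> real" where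
  "spike d j a = (\<lambda>k\<in>{..<d}. if k = j then a else 0)"

text \<open>The map acts coordinatewise, so preimages of rectangles are rectangles. The product form
  makes \<open>PiM_density\<close> applicable.\<close>

lemma shift_law_eq_PiM:
  assumes \<nu>: "noise_law c C \<nu>"
  shows "shift_law \<nu> \<sigma> d \<theta> = (\<Pi>\<^sub>M j\<in>{..<d}. distr \<nu> borel (\<lambda>x. \<theta> j + \<sigma> * x))"
proof (rule PiM_eqI_prob_space)
  interpret \<nu>: prob_space \<nu>
    using \<nu> by (simp add: noise_law_def)
  have [measurable_cong, simp]: "sets \<nu> = sets borel"
    using \<nu> by (auto simp: noise_law_def)
  show "prob_space (distr \<nu> borel (\<lambda>x. \<theta> j + \<sigma> * x))" for j
    by (rule \<nu>.prob_space_distr) simp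
  show "sets (shift_law \<nu> \<sigma> d \<theta>) = sets (\<Pi>\<^sub>M j\<in>{..<d}. distr \<nu> borel (\<lambda>x. \<theta> j + \<sigma> * x))"
    unfolding shift_law_def Rvec_def by (subst sets_distr, rule sets_PiM_cong) auto
  fix A assume "\<And>j. j \<in> {..<d} \<Longrightarrow> A j \<in> sets (distr \<nu> borel (\<lambda>x. \<theta> j + \<sigma> * x))"
  then have A[measurable]: "A j \<in> sets borel" if "j \<in> {..<d}" for j
    using that by simp
  let ?B = "\<lambda>j. (\<lambda>x. \<theta> j + \<sigma> * x) -` A j \<inter> space \<nu>"
  have B: "?B j \<in> sets \<nu>" if "j \<in> {..<d}" for j
    using that A[OF that] by (intro measurable_sets[of _ \<nu> borel]) auto
  have "emeasure (shift_law \<nu> \<sigma> d \<theta>) (Pi\<^sub>E {..<d} A) =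
    emeasure (\<Pi>\<^sub>M j\<in>{..<d}. \<nu>) ((\<lambda>\<xi>. \<lambda>j\<in>{..<d}. \<theta> j + \<sigma> * \<xi> j) -` Pi\<^sub>E {..<d} A \<inter> space (\<Pi>\<^sub>M j\<in>{..<d}. \<nu>))"
    unfolding shift_law_def Rvec_def
  proof (rule emeasure_distr)
    show "(\<lambda>\<xi>. \<lambda>j\<in>{..<d}. \<theta> j + \<sigma> * \<xi> j) \<in> (\<Pi>\<^sub>M j\<in>{..<d}. \<nu>) \<rightarrow>\<^sub>M (\<Pi>\<^sub>M j\<in>{..<d}. borel)"
      by measurable
    show "Pi\<^sub>E {..<d} A \<in> sets (\<Pi>\<^sub>M j\<in>{..<d}. borel)"
      by (intro sets_PiM_I_finite A) auto
  qed
  also have "(\<lambda>\<xi>. \<lambda>j\<in>{..<d}. \<theta> j + \<sigma> * \<xi> j) -` Pi\<^sub>E {..<d} A \<inter> space (\<Pi>\<^sub>M j\<in>{..<d}. \<nu>) = Pi\<^sub>E {..<d} ?B"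
    by (auto simp: space_PiM PiE_iff)
  also have "emeasure (\<Pi>\<^sub>M j\<in>{..<d}. \<nu>) (Pi\<^sub>E {..<d} ?B) = (\<Prod>j\<in>{..<d}. emeasure \<nu> (?B j))"
    by (intro emeasure_PiM_PiE B) (auto intro: \<nu>.prob_space_axioms)
  also have "\<dots> = (\<Prod>j\<in>{..<d}. emeasure (distr \<nu> borel (\<lambda>x. \<theta> j + \<sigma> * x)) (A j))"
    by (intro prod.cong refl emeasure_distr[symmetric] A) auto
  finally show "emeasure (shift_law \<nu> \<sigma> d \<theta>) (Pi\<^sub>E {..<d} A) =
    (\<Prod>j\<in>{..<d}. emeasure (distr \<nu> borel (\<lambda>x. \<theta> j + \<sigma> * x)) (A j))" .
qed simp

text \<open>The null law and the law with a spike at \<open>j\<close> differ in one factor, so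
  \<open>F j x\<close> is \<open>w (x j) - 1\<close> for a one-dimensional density \<open>w\<close>.
  Under the null law the \<open>F j\<close> are independent and centered, hence orthogonal.\<close>

lemma shift_law_spike_density:
  fixes d :: nat and a \<sigma> :: real
  assumes \<nu>: "noise_law c C \<nu>" and \<sigma>: "0 < \<sigma>"
  defines "P \<equiv> shift_law \<nu> \<sigma> d (\<lambda>j\<in>{..<d}. 0)"
  obtains F :: "nat \<Rightarrow> (nat \<Rightarrow> real) \<Rightarrow> real" where
    "\<And>j. j < d \<Longrightarrow> F j \<in> borel_measurable P"
    "\<And>j x. 0 \<le> 1 + F j x"
    "\<And>j. j < d \<Longrightarrow> shift_law \<nu> \<sigma> d (spike d j a) = density P (\<lambda>x. ennreal (1 + F j x))"
    "\<And>j. j < d \<Longrightarrow> integrable P (\<lambda>x. (F j x)\<^sup>2)"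
    "\<And>j. j < d \<Longrightarrow> (\<integral>x. F j x \<partial>P) = 0"
    "\<And>j. j < d \<Longrightarrow> (\<integral>x. (F j x)\<^sup>2 \<partial>P) \<le> exp (C * (a / \<sigma>)\<^sup>2) - 1"
    "\<And>j k. j < d \<Longrightarrow> k < d \<Longrightarrow> j \<noteq> k \<Longrightarrow> (\<integral>x. F j x * F k x \<partial>P) = 0"
proof -
  interpret \<nu>: prob_space \<nu>
    using \<nu> by (simp add: noise_law_def)
  have [measurable_cong, simp]: "sets \<nu> = sets borel"
    using \<nu> by (auto simp: noise_law_def)
  define \<nu>\<^sub>0 where "\<nu>\<^sub>0 = distr \<nu> borel (\<lambda>x. 0 + \<sigma> * x)"
  interpret \<nu>0: prob_space \<nu>\<^sub>0
    unfolding \<nu>\<^sub>0_def by (rule \<nu>.prob_space_distr) simp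
  interpret prod: product_prob_space "\<lambda>_::nat. \<nu>\<^sub>0" "{..<d}" ..
  have \<nu>0_sets: "sets \<nu>\<^sub>0 = sets borel"
    by (simp add: \<nu>\<^sub>0_def)
  note [measurable_cong] = \<nu>0_sets
  obtain w where w[measurable]: "w \<in> borel_measurable borel" and w0: "\<And>y. 0 \<le> w y"
    and wd: "distr \<nu> borel (\<lambda>x. a + \<sigma> * x) = density \<nu>\<^sub>0 (\<lambda>y. ennreal (w y))"
    and w2: "integrable \<nu>\<^sub>0 (\<lambda>y. (w y)\<^sup>2)" and w1: "(\<integral>y. w y \<partial>\<nu>\<^sub>0) = 1"
    and chi: "(\<integral>y. (w y - 1)\<^sup>2 \<partial>\<nu>\<^sub>0) \<le> exp (C * (a / \<sigma>)\<^sup>2) - 1"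
    using noise_law_location_density[OF \<nu> \<sigma>, of a] unfolding \<nu>\<^sub>0_def by metis
  have P: "P = (\<Pi>\<^sub>M j\<in>{..<d}. \<nu>\<^sub>0)"
    unfolding P_def shift_law_eq_PiM[OF \<nu>] \<nu>\<^sub>0_def by (intro PiM_cong) auto
  have wi: "integrable \<nu>\<^sub>0 w"
    using w2 by (intro \<nu>0.square_integrable_imp_integrable[where f=w]) auto
  have wm: "integrable \<nu>\<^sub>0 (\<lambda>y. (w y - 1)\<^sup>2)"
    using wi w2 by (simp add: power2_diff)
  define F where "F j x = w (x j) - 1" for j and x :: "nat \<Rightarrow> real"
  have comp: "distr P \<nu>\<^sub>0 (\<lambda>x. x j) = \<nu>\<^sub>0" if "j < d" for j
    unfolding P using that by (intro distr_PiM_component) (auto intro: \<nu>0.prob_space_axioms)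
  have Pm: "(\<lambda>x. x j) \<in> P \<rightarrow>\<^sub>M \<nu>\<^sub>0" if "j < d" for j
    unfolding P using that by (intro measurable_component_singleton) auto
  have int: "(\<integral>x. f (x j) \<partial>P) = (\<integral>y. f y \<partial>\<nu>\<^sub>0)"
    and integrable: "integrable P (\<lambda>x. f (x j)) \<longleftrightarrow> integrable \<nu>\<^sub>0 f"
    if "j < d" and [measurable]: "f \<in> borel_measurable borel" for j and f :: "real \<Rightarrow> real"
    using integral_distr[OF Pm[OF that(1)], of f] integrable_distr_eq[OF Pm[OF that(1)], of f]
    by (simp_all add: comp[OF that(1)])
  show ?thesis
  proof
    fix j assume j: "j < d"
    show "F j \<in> borel_measurable P"
    proof -
      have [measurable]: "(\<lambda>x. x j) \<in> borel_measurable P"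
        using Pm[OF j] by (simp add: measurable_cong_sets[OF refl \<nu>0_sets])
      show ?thesis
        unfolding F_def by measurable
    qed
    show "integrable P (\<lambda>x. (F j x)\<^sup>2)"
      unfolding F_def using integrable[OF j, of "\<lambda>y. (w y - 1)\<^sup>2"] wm by simp
    show "(\<integral>x. F j x \<partial>P) = 0"
      unfolding F_def using int[OF j, of "\<lambda>y. w y - 1"] wi w1 by (simp add: \<nu>0.prob_space)
    show "(\<integral>x. (F j x)\<^sup>2 \<partial>P) \<le> exp (C * (a / \<sigma>)\<^sup>2) - 1"
      unfolding F_def using int[OF j, of "\<lambda>y. (w y - 1)\<^sup>2"] chi by simp
    \<comment> \<open>Densities of all factors with respect to the null factor: trivial except at
      the spike.\<close>
    define r where "r k = (\<lambda>y. if k = j then ennreal (w y) else 1)" for k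
    have rd: "density \<nu>\<^sub>0 (r k) = distr \<nu> borel (\<lambda>x. (if k = j then a else 0) + \<sigma> * x)" for k
      using wd by (auto simp: r_def density_1 \<nu>\<^sub>0_def)
    have "shift_law \<nu> \<sigma> d (spike d j a) = (\<Pi>\<^sub>M k\<in>{..<d}. density \<nu>\<^sub>0 (r k))"
      unfolding shift_law_eq_PiM[OF \<nu>] rd by (intro PiM_cong) (auto simp: spike_def)
    also have "\<dots> = density P (\<lambda>x. \<Prod>k\<in>{..<d}. r k (x k))"
      unfolding P
    proof (rule PiM_density)
      show "prob_space (density \<nu>\<^sub>0 (r k))" for k
        unfolding rd by (rule \<nu>.prob_space_distr) simp
    qed (auto simp: r_def intro: \<nu>0.prob_space_axioms)
    also have "(\<lambda>x. \<Prod>k\<in>{..<d}. r k (x k)) = (\<lambda>x. ennreal (1 + F j x))"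
      using j by (simp add: r_def F_def prod.delta)
    finally show "shift_law \<nu> \<sigma> d (spike d j a) = density P (\<lambda>x. ennreal (1 + F j x))" .
  next
    fix j k assume jk: "j < d" "k < d" "j \<noteq> k"
    \<comment> \<open>Padding with factors 1 writes \<open>F j x * F k x\<close> as a product over
      all coordinates, whose integral factorizes; the factor at \<open>j\<close> integrates to
      0.\<close>
    define f where "f l = (\<lambda>y. (if l = j then w y - 1 else 1) * (if l = k then w y - 1 else 1))" for l
    have fi: "integrable \<nu>\<^sub>0 (f l)" for l
      using wi jk by (cases "l = j"; cases "l = k") (auto simp: f_def)
    have "(\<integral>x. F j x * F k x \<partial>P) = (\<integral>x. (\<Prod>l\<in>{..<d}. f l (x l)) \<partial>P)"
      using jk by (simp add: f_def F_def prod.distrib prod.delta)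
    also have "\<dots> = (\<Prod>l\<in>{..<d}. \<integral>y. f l y \<partial>\<nu>\<^sub>0)"
      unfolding P by (rule prod.product_integral_prod[OF _ fi]) simp
    also have "\<dots> = 0"
    proof (rule prod_zero)
      have "(\<integral>y. f j y \<partial>\<nu>\<^sub>0) = 0"
        using jk wi w1 by (simp add: f_def \<nu>0.prob_space)
      then show "\<exists>l\<in>{..<d}. (\<integral>y. f l y \<partial>\<nu>\<^sub>0) = 0"
        using jk by auto
    qed simp
    finally show "(\<integral>x. F j x * F k x \<partial>P) = 0" .
  qed (simp add: F_def w0)
qed

text \<open>\<open>S j\<close> adds up, over the observations, the chi-square divergences between
  the channel outputs for the spike at \<open>j\<close> and for the null vector.
  \<open>private_channel_chi_square\<close> bounds the sum over \<open>j\<close> for each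
  observation separately, so the channels may vary with the observation and the total acquires the
  factor \<open>n\<close>.\<close>

lemma privatized_law_spike:
  fixes n d :: nat and a \<sigma> :: real
  assumes \<nu>: "noise_law c C \<nu>" and \<sigma>: "0 < \<sigma>" and \<alpha>: "0 \<le> \<alpha>" and C: "0 \<le> C"
    and Q: "Q \<in> private_mechanisms n d \<alpha>"
  defines "M\<^sub>0 \<equiv> privatized_law n Q (shift_law \<nu> \<sigma> d (\<lambda>j\<in>{..<d}. 0))"
    and "M\<^sub>1 \<equiv> \<lambda>j. privatized_law n Q (shift_law \<nu> \<sigma> d (spike d j a))"
  obtains S :: "nat \<Rightarrow> real" where
    "prob_space M\<^sub>0" "sets M\<^sub>0 = sets (Rsample n d)"
    "\<And>j. j < d \<Longrightarrow> prob_space (M\<^sub>1 j)" "\<And>j. j < d \<Longrightarrow> sets (M\<^sub>1 j) = sets (Rsample n d)"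
    "\<And>j. 0 \<le> S j" "(\<Sum>j<d. S j) \<le> real n * ((exp \<alpha> - 1)\<^sup>2 * (exp (C * (a / \<sigma>)\<^sup>2) - 1))"
    "\<And>j A. j < d \<Longrightarrow> A \<in> sets (Rsample n d) \<Longrightarrow>
      (measure (M\<^sub>1 j) A)\<^sup>2 \<le> measure M\<^sub>0 A * exp (S j)"
proof -
  define P where "P = shift_law \<nu> \<sigma> d (\<lambda>j\<in>{..<d}. 0)"
  define v where "v = exp (C * (a / \<sigma>)\<^sup>2) - 1"
  obtain F :: "nat \<Rightarrow> (nat \<Rightarrow> real) \<Rightarrow> real" where
    F: "\<And>j. j < d \<Longrightarrow> F j \<in> borel_measurable P" "\<And>j x. 0 \<le> 1 + F j x"
    and spike: "\<And>j. j < d \<Longrightarrow> shift_law \<nu> \<sigma> d (spike d j a) = density P (\<lambda>x. ennreal (1 + F j x))"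
    and F': "\<And>j. j < d \<Longrightarrow> integrable P (\<lambda>x. (F j x)\<^sup>2)"
      "\<And>j. j < d \<Longrightarrow> (\<integral>x. F j x \<partial>P) = 0"
      "\<And>j. j < d \<Longrightarrow> (\<integral>x. (F j x)\<^sup>2 \<partial>P) \<le> v"
      "\<And>j k. j < d \<Longrightarrow> k < d \<Longrightarrow> j \<noteq> k \<Longrightarrow> (\<integral>x. F j x * F k x \<partial>P) = 0"
  proof (rule shift_law_spike_density[OF \<nu> \<sigma>, of d a, folded P_def v_def], goal_cases)
    case (1 F)
    show ?case
      by (rule 1(1)[OF 1(2-)])
  qed
  have law: "prob_space (shift_law \<nu> \<sigma> d \<theta>)" "sets (shift_law \<nu> \<sigma> d \<theta>) = sets (Rvec d)" for \<theta>
  proof -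
    interpret \<nu>: prob_space \<nu>
      using \<nu> by (simp add: noise_law_def)
    have [measurable_cong, simp]: "sets \<nu> = sets borel"
      using \<nu> by (auto simp: noise_law_def)
    show "prob_space (shift_law \<nu> \<sigma> d \<theta>)"
      unfolding shift_law_eq_PiM[OF \<nu>] by (intro prob_space_PiM \<nu>.prob_space_distr) simp
    show "sets (shift_law \<nu> \<sigma> d \<theta>) = sets (Rvec d)"
      by (simp add: shift_law_def)
  qed
  have Pp: "prob_space P" and Ps: "sets P = sets (Rvec d)"
    unfolding P_def by (rule law)+
  have v0: "0 \<le> v"
    using C by (simp add: v_def)
  have Qm: "Q i \<in> R \<rightarrow>\<^sub>M prob_algebra (Rvec d)" if "i < n" "sets R = sets (Rvec d)" for i R
    using Q that by (auto simp: private_mechanisms_def cong: measurable_cong_sets)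
  have bindp: "prob_space (R \<bind> Q i)" and binds: "sets (R \<bind> Q i) = sets (Rvec d)"
    if "prob_space R" "sets R = sets (Rvec d)" "i < n" for R i
    using prob_space_bind'[OF _ Qm[OF that(3,2)], of R] sets_bind'[OF _ Qm[OF that(3,2)], of R] that(1)
    by (auto simp: space_prob_algebra)
  have priv: "emeasure (Q i x) A \<le> ennreal (exp \<alpha>) * emeasure (Q i x') A"
    if "i < n" "A \<in> sets (Rvec d)" "x \<in> space P" "x' \<in> space P" for i A x x'
  proof -
    have x: "x \<in> space (Rvec d)" "x' \<in> space (Rvec d)"
      using that sets_eq_imp_space_eq[OF Ps] by auto
    then have "prob_space (Q i x)" "prob_space (Q i x')"
      using measurable_space[OF Qm[OF that(1) refl]] by (auto simp: space_prob_algebra)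
    then have eq: "emeasure (Q i x) A = ennreal (measure (Q i x) A)"
      "emeasure (Q i x') A = ennreal (measure (Q i x') A)"
      by (auto simp: finite_measure.emeasure_eq_measure prob_space.finite_measure)
    have "measure (Q i x) A \<le> exp \<alpha> * measure (Q i x') A"
      using Q that x by (auto simp: private_mechanisms_def)
    then show ?thesis
      unfolding eq by (simp add: ennreal_mult'[symmetric] ennreal_leI)
  qed
  \<comment> \<open>The conclusion of the one-observation bound as a predicate, so that one family
    of densities can be chosen for every observation.\<close>
  define \<Phi> where "\<Phi> i r \<longleftrightarrow>
    (\<forall>j\<in>{..<d}. r j \<in> borel_measurable (Rvec d) \<and> (\<forall>z. 0 \<le> r j z \<and> r j z \<le> exp \<alpha>) \<and>
       density P (\<lambda>x. ennreal (1 + F j x)) \<bind> Q i = density (P \<bind> Q i) (\<lambda>z. ennreal (r j z))) \<and>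
    (\<Sum>j\<in>{..<d}. \<integral>z. (r j z - 1)\<^sup>2 \<partial>(P \<bind> Q i)) \<le> (exp \<alpha> - 1)\<^sup>2 * v"
    for i and r :: "nat \<Rightarrow> (nat \<Rightarrow> real) \<Rightarrow> real"
  have ex: "\<exists>r. \<Phi> i r" if i: "i < n" for i
    unfolding \<Phi>_def
    by (rule private_channel_chi_square[OF Pp finite_lessThan \<alpha> Qm[OF i Ps] priv[OF i]])
      (use F F' v0 in auto)
  define r where "r i = (SOME r. \<Phi> i r)" for i
  have \<Phi>: "\<Phi> i (r i)" if "i < n" for i
    unfolding r_def by (rule someI_ex[OF ex[OF that]])
  have r: "r i j \<in> borel_measurable (Rvec d)" "0 \<le> r i j z" "r i j z \<le> exp \<alpha>"
    "density P (\<lambda>x. ennreal (1 + F j x)) \<bind> Q i = density (P \<bind> Q i) (\<lambda>z. ennreal (r i j z))"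
    if "i < n" "j < d" for i j z
    using \<Phi>[OF that(1)] that(2) unfolding \<Phi>_def by blast+
  have rS: "(\<Sum>j<d. \<integral>z. (r i j z - 1)\<^sup>2 \<partial>(P \<bind> Q i)) \<le> (exp \<alpha> - 1)\<^sup>2 * v" if "i < n" for i
    using \<Phi>[OF that] unfolding \<Phi>_def by blast
  have priv_PiM: "privatized_law n Q R = (\<Pi>\<^sub>M i\<in>{..<n}. R \<bind> Q i)"
    if "prob_space R" "sets R = sets (Rvec d)" for R
    unfolding privatized_law_def using that
    by (intro bind_PiM_kernel[where N="\<lambda>_. Rvec d"]) (simp_all add: Qm)
  have M_prob: "prob_space (privatized_law n Q R)"
    if "prob_space R" "sets R = sets (Rvec d)" for R
    unfolding priv_PiM[OF that] by (rule prob_space_PiM, rule bindp[OF that]) simp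
  have M_sets: "sets (privatized_law n Q R) = sets (Rsample n d)"
    if "prob_space R" "sets R = sets (Rvec d)" for R
    unfolding priv_PiM[OF that] Rsample_def by (rule sets_PiM_cong[OF refl], rule binds[OF that]) simp
  have M0: "M\<^sub>0 = (\<Pi>\<^sub>M i\<in>{..<n}. P \<bind> Q i)"
    unfolding M\<^sub>0_def P_def by (rule priv_PiM[OF law])
  have M1: "M\<^sub>1 j = (\<Pi>\<^sub>M i\<in>{..<n}. density (P \<bind> Q i) (\<lambda>z. ennreal (r i j z)))" if j: "j < d" for j
    unfolding M\<^sub>1_def priv_PiM[OF law] spike[OF j] by (intro PiM_cong refl r(4)[OF _ j]) simp
  define S where "S j = (\<Sum>i<n. \<integral>z. (r i j z - 1)\<^sup>2 \<partial>(P \<bind> Q i))" for j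
  show ?thesis
  proof
    show "prob_space M\<^sub>0" "sets M\<^sub>0 = sets (Rsample n d)"
      unfolding M\<^sub>0_def by (rule M_prob[OF law] M_sets[OF law])+
    show "prob_space (M\<^sub>1 j)" "sets (M\<^sub>1 j) = sets (Rsample n d)" for j
      unfolding M\<^sub>1_def by (rule M_prob[OF law] M_sets[OF law])+
    show "0 \<le> S j" for j
      unfolding S_def by (intro sum_nonneg) auto
    \<comment> \<open>The sums are exchanged because the available bound is per observation, summed
      over the coordinates.\<close>
    have "(\<Sum>j<d. S j) = (\<Sum>i<n. \<Sum>j<d. \<integral>z. (r i j z - 1)\<^sup>2 \<partial>(P \<bind> Q i))"
      unfolding S_def by (rule sum.swap)
    also have "\<dots> \<le> (\<Sum>i<n. (exp \<alpha> - 1)\<^sup>2 * v)"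
      by (intro sum_mono rS) simp
    finally show "(\<Sum>j<d. S j) \<le> real n * ((exp \<alpha> - 1)\<^sup>2 * (exp (C * (a / \<sigma>)\<^sup>2) - 1))"
      by (simp add: v_def)
    fix j A assume j: "j < d" and A: "A \<in> sets (Rsample n d)"
    show "(measure (M\<^sub>1 j) A)\<^sup>2 \<le> measure M\<^sub>0 A * exp (S j)"
      unfolding M1[OF j] M0 S_def
    proof (rule measure_PiM_density_square_le)
      fix i assume "i \<in> {..<n}"
      then have i: "i < n" by simp
      show p: "prob_space (P \<bind> Q i)"
        by (rule bindp[OF Pp Ps i])
      show m: "r i j \<in> borel_measurable (P \<bind> Q i)"
        using r(1)[OF i j] binds[OF Pp Ps i] by (simp cong: measurable_cong_sets)
      show "0 \<le> r i j z" for z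
        by (rule r(2)[OF i j])
      show "integrable (P \<bind> Q i) (\<lambda>z. (r i j z)\<^sup>2)"
      proof -
        interpret PQ: prob_space "P \<bind> Q i" by (rule p)
        show ?thesis
          using m r(2,3)[OF i j]
          by (intro PQ.integrable_const_bound[of _ "(exp \<alpha>)\<^sup>2"]) (auto intro!: AE_I2 power_mono)
      qed
      show "prob_space (density (P \<bind> Q i) (\<lambda>z. ennreal (r i j z)))"
        unfolding r(4)[OF i j, symmetric] spike[OF j, symmetric] by (rule bindp[OF law i])
    next
      show "A \<in> sets (\<Pi>\<^sub>M i\<in>{..<n}. P \<bind> Q i)"
        using A M_sets[OF law] unfolding M0[symmetric] M\<^sub>0_def by blast
    qed simp
  qed
qed

section \<open>Lower bound for the Hamming risk in a fixed dimension\<close>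

lemma hamming_risk_lower_bound:
  assumes \<nu>: "noise_law c C \<nu>" and \<sigma>: "0 < \<sigma>" and \<alpha>: "0 \<le> \<alpha>" and C: "0 \<le> C"
    and d: "2 \<le> d" and s: "1 \<le> s" and a: "0 < a"
    and Q: "Q \<in> private_mechanisms n d \<alpha>" and h: "h \<in> separable_selectors n d"
    and small: "real n * ((exp \<alpha> - 1)\<^sup>2 * (exp (C * (a / \<sigma>)\<^sup>2) - 1)) \<le> real d * ln (real d) / 64"
  shows "1 / 8 \<le> (SUP \<theta>\<in>sparse_class d s a. hamming_risk \<nu> \<sigma> n d Q h \<theta>)"
proof (rule ccontr)
  define M\<^sub>0 where "M\<^sub>0 = privatized_law n Q (shift_law \<nu> \<sigma> d (\<lambda>j\<in>{..<d}. 0))"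
  define M\<^sub>1 where "M\<^sub>1 j = privatized_law n Q (shift_law \<nu> \<sigma> d (spike d j a))" for j
  define R where "R = (SUP \<theta>\<in>sparse_class d s a. hamming_risk \<nu> \<sigma> n d Q h \<theta>)"
  assume "\<not> 1 / 8 \<le> (SUP \<theta>\<in>sparse_class d s a. hamming_risk \<nu> \<sigma> n d Q h \<theta>)"
  then have R: "R < 1 / 8"
    by (simp add: R_def)
  have e8: "(1 / 8 :: ennreal) = ennreal (1 / 8)"
    using divide_ennreal[of 1 8] by simp
  obtain S where S: "prob_space M\<^sub>0" "sets M\<^sub>0 = sets (Rsample n d)"
    "\<And>j. j < d \<Longrightarrow> prob_space (M\<^sub>1 j)" "\<And>j. j < d \<Longrightarrow> sets (M\<^sub>1 j) = sets (Rsample n d)"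
    "\<And>j. 0 \<le> S j" "(\<Sum>j<d. S j) \<le> real n * ((exp \<alpha> - 1)\<^sup>2 * (exp (C * (a / \<sigma>)\<^sup>2) - 1))"
    and sq: "\<And>j A. j < d \<Longrightarrow> A \<in> sets (Rsample n d) \<Longrightarrow>
      (measure (M\<^sub>1 j) A)\<^sup>2 \<le> measure M\<^sub>0 A * exp (S j)"
    using privatized_law_spike[OF \<nu> \<sigma> \<alpha> C Q, of a] unfolding M\<^sub>0_def M\<^sub>1_def by metis
  interpret M0: prob_space M\<^sub>0 by (rule S)
  \<comment> \<open>The event that coordinate \<open>j\<close> is selected: an error under the null
    vector, while its complement is an error under the spike at \<open>j\<close>.\<close>
  define A where "A j = (\<lambda>z. h z j) -` {1} \<inter> space (Rsample n d)" for j
  have A: "A j \<in> sets (Rsample n d)" if "j < d" for j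
  proof -
    have "h \<in> Rsample n d \<rightarrow>\<^sub>M (\<Pi>\<^sub>M j\<in>{..<d}. count_space {0, 1})"
      using h by (simp add: separable_selectors_def)
    moreover have "(\<lambda>v. v j) \<in> (\<Pi>\<^sub>M j\<in>{..<d}. count_space {0, 1}) \<rightarrow>\<^sub>M count_space {0, 1::nat}"
      using that by (intro measurable_component_singleton) simp
    ultimately have "(\<lambda>z. h z j) \<in> Rsample n d \<rightarrow>\<^sub>M count_space {0, 1}"
      by (rule measurable_compose)
    then show ?thesis
      unfolding A_def by (rule measurable_sets) simp
  qed
  have zero: "(\<lambda>j\<in>{..<d}. 0) \<in> sparse_class d s a"
    unfolding sparse_class_def by (auto intro!: exI[of _ "{}"])
  have spike: "spike d j a \<in> sparse_class d s a" if "j < d" for j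
    using that s a unfolding sparse_class_def by (auto intro!: exI[of _ "{j}"] simp: spike_def)
  \<comment> \<open>Each false positive costs one unit of loss at the null vector, so the
    probabilities of the \<open>A j\<close> sum to at most the risk there.\<close>
  have "ennreal (\<Sum>j<d. measure M\<^sub>0 (A j)) = (\<Sum>j<d. emeasure M\<^sub>0 (A j))"
    by (simp add: M0.emeasure_eq_measure)
  also have "\<dots> = (\<integral>\<^sup>+z. (\<Sum>j<d. indicator (A j) z) \<partial>M\<^sub>0)"
    using A by (subst nn_integral_sum) (auto simp: S(2) intro!: borel_measurable_indicator)
  also have "\<dots> \<le> hamming_risk \<nu> \<sigma> n d Q h (\<lambda>j\<in>{..<d}. 0)"
    unfolding hamming_risk_def M\<^sub>0_def[symmetric]
  proof (rule nn_integral_mono)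
    fix z
    have "(\<Sum>j<d. indicator (A j) z) = ennreal (\<Sum>j<d. indicator (A j) z)"
      by (subst sum_ennreal[symmetric]) (auto simp: ennreal_indicator)
    also have "\<dots> \<le> ennreal (real (hamming d (h z) (support_pattern d (\<lambda>j\<in>{..<d}. 0))))"
      unfolding hamming_def of_nat_sum
      by (intro ennreal_leI sum_mono) (auto simp: support_pattern_def A_def indicator_def)
    finally show "(\<Sum>j<d. indicator (A j) z) \<le> ennreal (real (hamming d (h z) (support_pattern d (\<lambda>j\<in>{..<d}. 0))))" .
  qed
  also have "\<dots> \<le> R"
    unfolding R_def using zero by (rule SUP_upper)
  also have "\<dots> < ennreal (1 / 8)"
    using R e8 by simp
  finally have sum0: "(\<Sum>j<d. measure M\<^sub>0 (A j)) < 1 / 8"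
    by (subst (asm) ennreal_less_iff) (auto intro: sum_nonneg)
  have lnd: "0 < ln (real d)"
    using d by simp
  have sumS: "(\<Sum>j<d. S j) \<le> real d * ln (real d) / 64"
    using S(6) small by linarith
  have "\<exists>j<d. measure M\<^sub>0 (A j) \<le> 1 / (4 * real d) \<and> S j \<le> ln (real d) / 32"
  proof (rule ccontr)
    assume neg: "\<not> ?thesis"
    \<comment> \<open>\<open>K\<close> normalizes the budget for the \<open>S j\<close> to 1, just
      as the weight 8 normalizes the null risk to less than 1. Either violated threshold makes the
      weighted summand exceed \<open>2 / d\<close>; were every coordinate to violate one, the sum
      would exceed 2.\<close>
    define K where "K = 64 / (real d * ln (real d))"
    have K: "0 < K"
      using d lnd by (simp add: K_def)
    have "2 = (\<Sum>j<d. 2 / real d)"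
      using d by simp
    also have "\<dots> < (\<Sum>j<d. 8 * measure M\<^sub>0 (A j) + K * S j)"
    proof (rule sum_strict_mono)
      fix j assume "j \<in> {..<d}"
      with neg consider "1 / (4 * real d) < measure M\<^sub>0 (A j)" | "ln (real d) / 32 < S j"
        by fastforce
      then show "2 / real d < 8 * measure M\<^sub>0 (A j) + K * S j"
      proof cases
        case 1
        then have "2 / real d < 8 * measure M\<^sub>0 (A j)"
          by (simp add: field_simps)
        moreover have "0 \<le> K * S j"
          using K S(5) by simp
        ultimately show ?thesis
          by linarith
      next
        case 2
        then have "K * (ln (real d) / 32) < K * S j"
          using K by simp
        moreover have "K * (ln (real d) / 32) = 2 / real d"
          using lnd d by (simp add: K_def field_simps)
        moreover have "0 \<le> measure M\<^sub>0 (A j)"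
          by simp
        ultimately show ?thesis
          by linarith
      qed
    qed (use d in \<open>auto simp: lessThan_empty_iff\<close>)
    also have "\<dots> = 8 * (\<Sum>j<d. measure M\<^sub>0 (A j)) + K * (\<Sum>j<d. S j)"
      by (simp add: sum.distrib sum_distrib_left)
    also have "\<dots> < 2"
    proof -
      have "K * (\<Sum>j<d. S j) \<le> K * (real d * ln (real d) / 64)"
        using K sumS by (intro mult_left_mono) auto
      also have "\<dots> = 1"
        using lnd d by (simp add: K_def)
      finally show ?thesis
        using sum0 by linarith
    qed
    finally show False .
  qed
  then obtain j where j: "j < d" and j1: "measure M\<^sub>0 (A j) \<le> 1 / (4 * real d)" and j2: "S j \<le> ln (real d) / 32"
    by blast
  interpret M1: prob_space "M\<^sub>1 j" by (rule S(3)[OF j])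
  have "(measure (M\<^sub>1 j) (A j))\<^sup>2 \<le> measure M\<^sub>0 (A j) * exp (S j)"
    using j A by (intro sq) auto
  \<comment> \<open>Here \<open>exp (S j) \<le> d\<close> cancels the \<open>d\<close> in the false
    positive bound and leaves 1/4, the square of 1/2.\<close>
  also have "\<dots> \<le> 1 / (4 * real d) * exp (ln (real d))"
    using j1 j2 lnd by (intro mult_mono) auto
  also have "\<dots> = (1 / 2)\<^sup>2"
    using d by (simp add: power2_eq_square)
  finally have half: "measure (M\<^sub>1 j) (A j) \<le> 1 / 2"
    by (rule power2_le_imp_le) simp
  \<comment> \<open>The spike is thus missed with probability at least 1/2, and a miss costs at
    least one unit of loss.\<close>
  have "ennreal (1 / 2) \<le> ennreal (1 - measure (M\<^sub>1 j) (A j))"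
    using half by (intro ennreal_leI) simp
  also have "\<dots> = emeasure (M\<^sub>1 j) (space (M\<^sub>1 j) - A j)"
    using A[OF j] S(4)[OF j] by (subst M1.emeasure_eq_measure) (simp add: M1.prob_compl)
  also have "\<dots> = (\<integral>\<^sup>+z. indicator (space (M\<^sub>1 j) - A j) z \<partial>M\<^sub>1 j)"
    using A[OF j] S(4)[OF j] by (intro nn_integral_indicator[symmetric]) auto
  also have "\<dots> \<le> hamming_risk \<nu> \<sigma> n d Q h (spike d j a)"
    unfolding hamming_risk_def M\<^sub>1_def[symmetric]
  proof (rule nn_integral_mono)
    fix z assume z: "z \<in> space (M\<^sub>1 j)"
    then have zR: "z \<in> space (Rsample n d)"
      using sets_eq_imp_space_eq[OF S(4)[OF j]] by simp
    show "indicator (space (M\<^sub>1 j) - A j) z \<le> ennreal (real (hamming d (h z) (support_pattern d (spike d j a))))"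
    proof (cases "z \<in> A j")
      case False
      then have "h z j \<noteq> support_pattern d (spike d j a) j"
        using j a zR by (auto simp: A_def support_pattern_def spike_def)
      then have "1 \<le> hamming d (h z) (support_pattern d (spike d j a))"
        unfolding hamming_def using j
        by (intro order_trans[OF _ member_le_sum[of j]]) auto
      then show ?thesis
        using False z by (simp add: one_ennreal_def[symmetric] del: ennreal_of_nat_eq_real_of_nat)
    qed simp
  qed
  also have "\<dots> \<le> R"
    unfolding R_def using spike[OF j] by (rule SUP_upper)
  finally have "ennreal (1 / 2) \<le> R" .
  then have "ennreal (1 / 2) < ennreal (1 / 8)"
    using R unfolding e8 by (rule le_less_trans)
  then show False
    by (subst (asm) ennreal_less_iff) auto
qed

section \<open>Calibration of the constants and passage to the limit\<close>

lemma exp_minus_one_le_double: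
  assumes "0 \<le> x" "x \<le> (1::real)"
  shows "exp x - 1 \<le> 2 * x"
proof -
  have "exp x \<le> 1 + x + x\<^sup>2"
    using assms by (rule exp_bound)
  moreover have "x\<^sup>2 \<le> x"
    using assms by (simp add: power2_eq_square mult_left_le)
  ultimately show ?thesis
    by linarith
qed

text \<open>\<open>N\<close>, \<open>D\<close>, \<open>l\<close> and \<open>t\<close> stand for
  \<open>n\<close>, \<open>d\<close>, \<open>ln d\<close> and \<open>a / \<sigma>\<close>. By
  \<open>large\<close>, \<open>q = D * l / (N * \<alpha>\<^sup>2)\<close> is at most 1, which places
  \<open>t\<close> in the range of \<open>exp_le\<close>. The constant 16 enters squared: the
  exponential term is at most \<open>q / (256 * L)\<close>, hence at most \<open>q / 256\<close> as
  \<open>L\<close> is at least 1. The privacy factor is at most \<open>4 * \<alpha>\<^sup>2\<close>,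
  and \<open>N * 4 * \<alpha>\<^sup>2 * q / 256\<close> equals \<open>D * l / 64\<close>.\<close>

lemma information_budget:
  fixes N D l L C \<alpha> t :: real
  assumes N: "0 < N" and D: "0 < D" and l: "0 < l" and L: "1 \<le> L" and \<alpha>: "0 < \<alpha>" "\<alpha> \<le> 1" and t: "0 \<le> t"
    and exp_le: "\<And>x. 0 \<le> x \<Longrightarrow> x \<le> 2 \<Longrightarrow> exp (C * x\<^sup>2) - 1 \<le> L * x\<^sup>2"
    and large: "1 \<le> N * \<alpha>\<^sup>2 / D / l"
    and t_le: "t \<le> 1 / (16 * L) * sqrt (D * l / (N * \<alpha>\<^sup>2))"
  shows "N * ((exp \<alpha> - 1)\<^sup>2 * (exp (C * t\<^sup>2) - 1)) \<le> D * l / 64"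
proof -
  define q where "q = D * l / (N * \<alpha>\<^sup>2)"
  have q: "0 < q" "q \<le> 1"
    using N D l \<alpha> large by (simp_all add: q_def field_simps)
  have "t \<le> 1 / (16 * L) * sqrt q"
    using t_le by (simp add: q_def)
  also have "\<dots> \<le> 1 * 1"
    using L q by (intro mult_mono) (auto simp: field_simps)
  finally have "t \<le> 2"
    by simp
  then have 1: "exp (C * t\<^sup>2) - 1 \<le> L * t\<^sup>2"
    using t by (intro exp_le)
  have "t\<^sup>2 \<le> (1 / (16 * L) * sqrt q)\<^sup>2"
    using t t_le by (intro power_mono) (simp_all add: q_def)
  also have "\<dots> = q / (256 * L\<^sup>2)"
    using q by (simp add: power_mult_distrib power_divide)
  finally have "L * t\<^sup>2 \<le> L * (q / (256 * L\<^sup>2))"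
    using L by (intro mult_left_mono) auto
  also have "\<dots> = q / (256 * L)"
    using L by (simp add: power2_eq_square)
  also have "\<dots> \<le> q / 256"
    using L q by (intro divide_left_mono) auto
  finally have 2: "exp (C * t\<^sup>2) - 1 \<le> q / 256"
    using 1 by linarith
  have "(exp \<alpha> - 1)\<^sup>2 \<le> (2 * \<alpha>)\<^sup>2"
    using \<alpha> exp_minus_one_le_double[of \<alpha>] by (intro power_mono) auto
  then have 3: "(exp \<alpha> - 1)\<^sup>2 \<le> 4 * \<alpha>\<^sup>2"
    by (simp add: power_mult_distrib)
  have "(exp \<alpha> - 1)\<^sup>2 * (exp (C * t\<^sup>2) - 1) \<le> (exp \<alpha> - 1)\<^sup>2 * (q / 256)"
    using 2 by (intro mult_left_mono) auto
  also have "\<dots> \<le> 4 * \<alpha>\<^sup>2 * (q / 256)"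
    using 3 q by (intro mult_right_mono) auto
  finally have "N * ((exp \<alpha> - 1)\<^sup>2 * (exp (C * t\<^sup>2) - 1)) \<le> N * (4 * \<alpha>\<^sup>2 * (q / 256))"
    using N by (intro mult_left_mono) auto
  also have "\<dots> = D * l / 64"
    using N \<alpha> by (simp add: q_def field_simps)
  finally show ?thesis .
qed

theorem corollary3p8:
  fixes \<sigma> c C L :: real and \<nu> :: "real measure"
    and n s :: "nat \<Rightarrow> nat" and \<alpha> a :: "nat \<Rightarrow> real"
  assumes "\<sigma> > 0" and "c > 0" and "C > 0"
    and "noise_law c C \<nu>"
    and "L > 0" and "\<forall>x. 0 \<le> x \<and> x \<le> 2 \<longrightarrow> exp (C * x\<^sup>2) - 1 \<le> L * x\<^sup>2"
    and "\<forall>d\<ge>1. n d \<ge> 1 \<and> 1 \<le> s d \<and> s d \<le> d \<and> 0 < \<alpha> d \<and> \<alpha> d < 1 \<and> 0 < a d"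
    and "filterlim (\<lambda>d. real (n d) * (\<alpha> d)\<^sup>2 / real d) at_top sequentially"
    and "filterlim (\<lambda>d. (real (n d) * (\<alpha> d)\<^sup>2 / real d) / ln (real d)) at_top sequentially"
    and "\<forall>\<^sub>F d in sequentially.
           a d \<le> \<sigma> / (16 * L) * sqrt (real d * ln (real d) / (real (n d) * (\<alpha> d)\<^sup>2))"
  shows "liminf (\<lambda>d. INF Q\<in>private_mechanisms (n d) d (\<alpha> d).
                     INF h\<in>separable_selectors (n d) d.
                     SUP \<theta>\<in>sparse_class d (s d) (a d). hamming_risk \<nu> \<sigma> (n d) d Q h \<theta>)
           \<ge> (1 / 8 :: ennreal)"
proof (rule Liminf_bounded)
  \<comment> \<open>At \<open>x = 1\<close> the hypothesis on \<open>L\<close> reads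
    \<open>exp C - 1 \<le> L\<close>, and unit variance makes the left side at least 1.\<close>
  have L: "1 \<le> L"
    using noise_law_curvature_ge[OF assms(4)] assms(6)[rule_format, of 1] by simp
  have "\<forall>\<^sub>F d in sequentially. 1 \<le> (real (n d) * (\<alpha> d)\<^sup>2 / real d) / ln (real d)"
    using assms(9) by (simp add: filterlim_at_top)
  \<comment> \<open>From dimension 2 on, \<open>ln d\<close> is positive, as the budget and the
    averaging over coordinates require.\<close>
  with assms(10) eventually_ge_at_top[of 2]
  show "\<forall>\<^sub>F d in sequentially. 1 / 8 \<le> (INF Q\<in>private_mechanisms (n d) d (\<alpha> d).
          INF h\<in>separable_selectors (n d) d.
          SUP \<theta>\<in>sparse_class d (s d) (a d). hamming_risk \<nu> \<sigma> (n d) d Q h \<theta>)"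
  proof eventually_elim
    case (elim d)
    have d: "n d \<ge> 1" "1 \<le> s d" "0 < \<alpha> d" "\<alpha> d < 1" "0 < a d"
      using assms(7) elim by auto
    have "a d / \<sigma> \<le> 1 / (16 * L) * sqrt (real d * ln (real d) / (real (n d) * (\<alpha> d)\<^sup>2))"
      using elim(1) assms(1) by (simp add: field_simps)
    then have "real (n d) * ((exp (\<alpha> d) - 1)\<^sup>2 * (exp (C * (a d / \<sigma>)\<^sup>2) - 1)) \<le> real d * ln (real d) / 64"
      using d elim assms(1,6) L by (intro information_budget) auto
    then show ?case
      using d elim assms(1,3)
      by (intro INF_greatest hamming_risk_lower_bound[OF assms(4)]) auto
  qed
qed

end
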